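(* Let $\omega$ and $\nu$ be radial weights on $\mathbb{D}$ and $1<p<\infty$. If $P_\omega:L^p_\nu\to L^p_\nu$ is bounded, then $$D_p(\omega,\nu)=\sup_{n\in\mathbb{N}\cup\{0\}}\frac{\left(\nu_{np+1}\right)^{\frac1p}\left(\sigma_{np'+1}\right)^{\frac1{p'}}}{\omega_{2n+1}}\le\|P_\omega\|_{L^p_\nu\to L^p_\nu}<\infty .$$
   Context: Let $\mathbb{D}=\{z\in\mathbb{C}:|z|<1\}$, let $dA=\frac{dx\,dy}{\pi}$ be normalized area measure on $\mathbb{D}$, and let $\mathcal{H}(\mathbb{D})$ be the space of analytic functions in $\mathbb{D}$. A radial weight is a non-negative function $\omega\in L^1(\mathbb{D})$ with $\omega(z)=\omega(|z|)$ for all $z\in\mathbb{D}$; throughout it is assumed that $\widehat{\omega}(z)=\int_{|z|}^1\omega(s)\,ds>0$ for all $z\in\mathbb{D}$. For $0<p<\infty$, $L^p_\omega$ is the space of complex-valued measurable $f$ on $\mathbb{D}$ with $\|f\|_{L^p_\omega}^p=\int_{\mathbb{D}}|f|^p\omega\,dA<\infty$, and $A^p_\omega=L^p_\omega\cap\mathcal{H}(\mathbb{D})$. $B^\omega_z\in A^2_\omega$ denotes the reproducing kernel of $A^2_\omega$ at $z\in\mathbb{D}$: $f(z)=\int_{\mathbb{D}}f(\zeta)\overline{B^\omega_z(\zeta)}\omega(\zeta)\,dA(\zeta)$ for all $f\in A^2_\omega$. Equivalently $B^\omega_z(\zeta)=\sum_{n=0}^\infty\frac{(\overline z\zeta)^n}{2\omega_{2n+1}}$,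 where $\omega_x=\int_0^1r^x\omega(r)\,dr$ denotes the moments. The Bergman projection is $$P_\omega(f)(z)=\int_{\mathbb{D}}f(\zeta)\overline{B^\omega_z(\zeta)}\,\omega(\zeta)\,dA(\zeta),\quad z\in\mathbb{D};$$ boundedness $P_\omega:L^p_\nu\to L^p_\nu$ means that this is well defined for every $f\in L^p_\nu$ and $\|P_\omega(f)\|_{L^p_\nu}\le C\|f\|_{L^p_\nu}$ for some constant $C$; the operator norm is $\|P_\omega\|_{L^p_\nu\to L^p_\nu}$. Further, $p'=\frac{p}{p-1}$ and $\sigma=\left(\frac{\omega}{\nu^{1/p}}\right)^{p'}=\frac{\omega^{\frac{p}{p-1}}}{\nu^{\frac1{p-1}}}$, with $\sigma=0$ where $\omega=\nu=0$ and $\sigma=\infty$ where $\nu=0<\omega$; moments $\nu_x,\sigma_x$ are defined as for $\omega$ (possibly $+\infty$ for $\sigma$). Here $\mathbb{N}=\{1,2,\dots\}$. *)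

theory Defs
  imports "HOL-Complex_Analysis.Complex_Analysis"
begin

abbreviation unit_disc :: "complex set" ("\<bbbD>") where
  "\<bbbD> \<equiv> ball 0 1"

definition disc_area :: "complex measure" where
  "disc_area = density (lebesgue_on \<bbbD>) (\<lambda>_. ennreal (1 / pi))"

text \<open>Real powers on \<open>[0, \<infinity>]\<close>. Only exponents \<open>a > 0\<close> are used, so that \<open>\<infinity>\<close> is sent to \<open>\<infinity>\<close>.\<close>

definition enn_powr :: "ennreal \<Rightarrow> real \<Rightarrow> ennreal" where
  "enn_powr x a = (if x = top then top else ennreal (enn2real x powr a))"

text \<open>
  Weights are functions on the disc, with irrelevant values outside it. The last clause is the
  standing assumption that the tail integral is positive; that integral is taken in \<open>[0, \<infinity>]\<close>
  because it may be infinite at \<open>z = 0\<close> for a weight in \<open>L\<^sup>1(\<bbbD>)\<close>.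
\<close>

definition radial_weight :: "(complex \<Rightarrow> real) \<Rightarrow> bool" where
  "radial_weight w \<longleftrightarrow>
     integrable disc_area w \<and>
     (\<forall>z\<in>\<bbbD>. 0 \<le> w z \<and> w z = w (of_real (cmod z))) \<and>
     (\<forall>z\<in>\<bbbD>. (\<integral>\<^sup>+ s\<in>{cmod z<..<1}. ennreal (w (of_real s)) \<partial>lebesgue) > 0)"

definition moment :: "(complex \<Rightarrow> ennreal) \<Rightarrow> real \<Rightarrow> ennreal" where
  "moment w x = (\<integral>\<^sup>+ r\<in>{0<..<1}. ennreal (r powr x) * w (of_real r) \<partial>lebesgue)"

definition Lp_norm :: "real \<Rightarrow> (complex \<Rightarrow> real) \<Rightarrow> (complex \<Rightarrow> complex) \<Rightarrow> ennreal" where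
  "Lp_norm p w f = enn_powr (\<integral>\<^sup>+ z. ennreal (cmod (f z) powr p * w z) \<partial>disc_area) (1 / p)"

text \<open>
  \<open>L\<^sup>p\<close> consists of functions, not of equivalence classes: where the weight vanishes an
  element of the space is an arbitrary measurable function.
\<close>

definition Lp_space :: "real \<Rightarrow> (complex \<Rightarrow> real) \<Rightarrow> (complex \<Rightarrow> complex) set" where
  "Lp_space p w = {f \<in> borel_measurable disc_area. Lp_norm p w f < top}"

definition bergman_space :: "real \<Rightarrow> (complex \<Rightarrow> real) \<Rightarrow> (complex \<Rightarrow> complex) set" where
  "bergman_space p w = {f \<in> Lp_space p w. f holomorphic_on \<bbbD>}"

text \<open>
  The reproducing kernel is determined by its defining property on the disc only; the choice
  operator fixes arbitrary values outside the disc, which enter no integral below.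
\<close>

definition bergman_kernel :: "(complex \<Rightarrow> real) \<Rightarrow> complex \<Rightarrow> complex \<Rightarrow> complex" where
  "bergman_kernel w z =
     (SOME K. K \<in> bergman_space 2 w \<and>
        (\<forall>f\<in>bergman_space 2 w. f z = (\<integral>\<zeta>. f \<zeta> * cnj (K \<zeta>) * of_real (w \<zeta>) \<partial>disc_area)))"

definition bergman_projection ::
  "(complex \<Rightarrow> real) \<Rightarrow> (complex \<Rightarrow> complex) \<Rightarrow> complex \<Rightarrow> complex" where
  "bergman_projection w f z =
     (\<integral>\<zeta>. f \<zeta> * cnj (bergman_kernel w z \<zeta>) * of_real (w \<zeta>) \<partial>disc_area)"

text \<open>
  Boundedness on \<open>L\<^sup>p\<^sub>\<nu>\<close>. The first conjunct says that the integral defining the projection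
  converges absolutely at every point of the disc.
\<close>

definition bergman_projection_bounded ::
  "real \<Rightarrow> (complex \<Rightarrow> real) \<Rightarrow> (complex \<Rightarrow> real) \<Rightarrow> bool" where
  "bergman_projection_bounded p \<omega> \<nu> \<longleftrightarrow>
     (\<forall>f\<in>Lp_space p \<nu>. \<forall>z\<in>\<bbbD>.
        integrable disc_area (\<lambda>\<zeta>. f \<zeta> * cnj (bergman_kernel \<omega> z \<zeta>) * of_real (\<omega> \<zeta>))) \<and>
     (\<forall>f\<in>Lp_space p \<nu>. bergman_projection \<omega> f \<in> Lp_space p \<nu>) \<and>
     (\<exists>C::real. \<forall>f\<in>Lp_space p \<nu>.
        Lp_norm p \<nu> (bergman_projection \<omega> f) \<le> ennreal C * Lp_norm p \<nu> f)"

definition bergman_projection_norm ::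
  "real \<Rightarrow> (complex \<Rightarrow> real) \<Rightarrow> (complex \<Rightarrow> real) \<Rightarrow> ennreal" where
  "bergman_projection_norm p \<omega> \<nu> =
     Inf {C. \<forall>f\<in>Lp_space p \<nu>. Lp_norm p \<nu> (bergman_projection \<omega> f) \<le> C * Lp_norm p \<nu> f}"

definition conj_exponent :: "real \<Rightarrow> real" where
  "conj_exponent p = p / (p - 1)"

definition dual_weight ::
  "real \<Rightarrow> (complex \<Rightarrow> real) \<Rightarrow> (complex \<Rightarrow> real) \<Rightarrow> complex \<Rightarrow> ennreal" where
  "dual_weight p \<omega> \<nu> z =
     (if \<nu> z = 0 then (if \<omega> z = 0 then 0 else top)
      else ennreal ((\<omega> z / \<nu> z powr (1 / p)) powr conj_exponent p))"

definition D_const :: "real \<Rightarrow> (complex \<Rightarrow> real) \<Rightarrow> (complex \<Rightarrow> real) \<Rightarrow> ennreal" where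
  "D_const p \<omega> \<nu> =
     (SUP n::nat.
        enn_powr (moment (\<lambda>z. ennreal (\<nu> z)) (real n * p + 1)) (1 / p)
        * enn_powr (moment (dual_weight p \<omega> \<nu>) (real n * conj_exponent p + 1))
            (1 / conj_exponent p)
        / moment (\<lambda>z. ennreal (\<omega> z)) (2 * real n + 1))"

end

theory Submission
  imports Defs
begin

text \<open>
  The monomials are orthogonal with respect to every radial weight, because Lebesgue measure is
  invariant under rotations. This identifies the kernel with its power series, and it shows that
  \<open>P\<^sub>\<omega>\<close> sends \<open>z\<^sup>n g\<close>, for \<open>g \<ge> 0\<close> radial, to a multiple of \<open>z\<^sup>n\<close> given by an integral of \<open>g\<omega>\<close>.
  The extremal choice in Hoelder's inequality, \<open>g(z) = |z|\<^bsup>n(2-p)/(p-1)\<^esup> (\<omega>/\<nu>)\<^bsup>1/(p-1)\<^esup>\<close>,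
  makes both \<open>|z\<^sup>n g|\<^sup>p \<nu>\<close> and \<open>|z|\<^bsup>2n\<^esup> g\<omega>\<close> equal to \<open>|z|\<^bsup>np'\<^esup> \<sigma>\<close>. It is truncated to a set
  where it is bounded, and monotone convergence gives the bound. The set where \<open>\<nu> = 0 < \<omega>\<close> is
  negligible, since its indicator has norm zero but a nonzero projection if its measure is positive.
\<close>

section \<open>Rotation invariance of Lebesgue measure on the plane\<close>

text \<open>The moments integrate along a radius, while a weight is only known to be Lebesgue
  measurable on the disc. A radius is a null set of the plane, so measurability along it has to be
  extracted from radiality; hence the Borel profiles attached to radial functions before any change
  of variables. Nothing gives \<open>Lp_space p \<nu>\<close> inside the functions integrable
  against \<open>\<omega>\<close>. That integrability comes from convergence of the projection
  integral at the origin, where the kernel is a nonzero constant. With \<open>S\<close> the integral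
  of the truncated \<open>|z|^(n p') * \<sigma>\<close>, the test function has norm
  \<open>S powr (1 / p)\<close> and its pairing with \<open>z^n\<close> is \<open>S\<close>.
  Boundedness becomes \<open>S <= B * S powr (1 / p)\<close>, which bounds \<open>S\<close> only if
  \<open>S\<close> is finite beforehand; this forces the truncation. The constant is sharp: every
  disc integral is twice a moment, and the factors 2 cancel because
  \<open>1 / p + 1 / p' = 1\<close>.\<close>

text \<open>The library has invariance under orthogonal maps only for the type \<open>real^'n\<close>.\<close>

definition cvec :: "complex \<Rightarrow> real^2" where
  "cvec z = (\<chi> i. if i = 1 then Re z else Im z)"

lemma cvec_nth [simp]: "cvec z $ 1 = Re z" "cvec z $ 2 = Im z"
  by (simp_all add: cvec_def)

lemma cvec_measurable [measurable]: "cvec \<in> borel_measurable borel"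
proof (rule borel_measurable_continuous_onI)
  show "continuous_on UNIV cvec"
    unfolding cvec_def
  proof (rule continuous_on_vec_lambda)
    show "continuous_on UNIV (\<lambda>z. if i = 1 then Re z else Im z)" for i :: 2
      by (cases "i = 1") (auto intro: continuous_intros)
  qed
qed

text \<open>Lebesgue measure is determined by its values on boxes, and the preimage of a box under
  \<open>cvec\<close> is the complex box with the same side lengths.\<close>

lemma distr_cvec: "distr lborel borel cvec = (lborel :: (real^2) measure)"
proof (rule lborel_eqI [symmetric])
  fix l u :: "real^2"
  assume lu: "\<And>b. b \<in> Basis \<Longrightarrow> l \<bullet> b \<le> u \<bullet> b"
  have le: "l $ i \<le> u $ i" for i
    using lu[of "axis i 1"] by (simp add: axis_in_Basis_iff inner_axis)
  have vim: "cvec -` box l u = box (Complex (l$1) (l$2)) (Complex (u$1) (u$2))"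
    by (auto simp: mem_box_cart forall_2 in_box_complex_iff)
  have "emeasure (distr lborel borel cvec) (box l u) = emeasure lborel (cvec -` box l u)"
    by (subst emeasure_distr) auto
  also have "\<dots> = ennreal ((u$1 - l$1) * (u$2 - l$2))"
    unfolding vim using le by (subst emeasure_lborel_box) (auto simp: Basis_complex_def inner_complex_def)
  also have "(u$1 - l$1) * (u$2 - l$2) = (\<Prod>b\<in>Basis. (u - l) \<bullet> b)"
    by (simp add: Basis_vec_def UNION_singleton_eq_range UNIV_2 inner_axis axis_eq_axis)
  finally show "emeasure (distr lborel borel cvec) (box l u) = (\<Prod>b\<in>Basis. (u - l) \<bullet> b)" by simp
qed simp

text \<open>It is enough to measure preimages of boxes. Such a preimage is the image under the
  inverse rotation, which becomes an orthogonal map once \<open>cvec\<close> has moved the problem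
  to \<open>real^2\<close>.\<close>

lemma lborel_complex_rotate:
  fixes c :: complex
  assumes "cmod c = 1"
  shows "distr lborel borel ((*) c) = lborel"
proof (rule lborel_eqI [symmetric])
  fix l u :: complex
  assume lu: "\<And>b. b \<in> Basis \<Longrightarrow> l \<bullet> b \<le> u \<bullet> b"
  \<comment> \<open>For \<open>cmod c = 1\<close> multiplication by \<open>cnj c\<close> inverts
    multiplication by \<open>c\<close>. This turns the preimage into an image, the form in which
    orthogonal maps are known to preserve measure.\<close>
  define T :: "real^2 \<Rightarrow> real^2"
    where "T v = cvec (cnj c * Complex (v$1) (v$2))" for v
  define B where "B = box (cvec l) (cvec u)"
  have cc: "c * cnj c = 1"
    using assms by (simp add: complex_norm_square [symmetric])
  have sq: "Re c * Re c + Im c * Im c = 1"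
    using assms cmod_power2[of c] by (simp add: power2_eq_square)
  have inj: "T v = T w \<Longrightarrow> v = w" for v w
  proof -
    assume "T v = T w"
    then have "cnj c * Complex (v$1) (v$2) = cnj c * Complex (w$1) (w$2)"
      by (auto simp: T_def vec_eq_iff forall_2 complex_eq_iff)
    with cc have "Complex (v$1) (v$2) = Complex (w$1) (w$2)"
      by auto
    then show "v = w" by (simp add: vec_eq_iff forall_2)
  qed
  have T: "orthogonal_transformation T"
  proof -
    have "linear T"
      by (rule linearI) (simp_all add: T_def vec_eq_iff forall_2 algebra_simps)
    moreover have "norm (T v) = norm v" for v
    proof -
      have "(norm (T v))\<^sup>2 = (Re c * Re c + Im c * Im c) * ((v$1)\<^sup>2 + (v$2)\<^sup>2)"
        unfolding T_def power2_norm_eq_inner inner_vec_def sum_2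
        by (simp add: power2_eq_square algebra_simps)
      also have "\<dots> = (norm v)\<^sup>2"
        unfolding sq power2_norm_eq_inner inner_vec_def sum_2 by (simp add: power2_eq_square)
      finally show ?thesis by simp
    qed
    ultimately show ?thesis by (simp add: orthogonal_transformation)
  qed
  have vimB: "cvec -` B = box l u"
    by (auto simp: B_def mem_box_cart forall_2 in_box_complex_iff)
  have B: "B \<in> lmeasurable" by (simp add: B_def)
  have TB: "T ` B \<in> lmeasurable" "measure lebesgue (T ` B) = measure lebesgue B"
    by (rule measurable_orthogonal_image[OF T B], rule measure_orthogonal_image[OF T B])
  \<comment> \<open>Lebesgue measurability of the image is not enough below: transport along
    \<open>cvec\<close> requires a Borel set.\<close>
  have "open (T ` B)"
    using T by (auto intro!: open_surjective_linear_image orthogonal_transformation_linear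
        orthogonal_transformation_surj simp: B_def)
  then have [measurable]: "T ` B \<in> sets borel" by simp
  have "((*) c) -` box l u = cvec -` (T ` B)"
  proof (intro set_eqI)
    fix z
    have "T (cvec w) = cvec (cnj c * w)" for w
      by (simp only: T_def cvec_nth complex.collapse)
    moreover have "cnj c * (c * z) = z"
      using cc by (metis mult.assoc mult.commute mult_1)
    ultimately have "cvec z = T (cvec (c * z))"
      by metis
    with inj have "cvec z \<in> T ` B \<longleftrightarrow> cvec (c * z) \<in> B"
      by (metis imageE imageI)
    with vimB show "z \<in> ((*) c) -` box l u \<longleftrightarrow> z \<in> cvec -` (T ` B)"
      by blast
  qed
  then have "emeasure (distr lborel borel ((*) c)) (box l u) = emeasure lborel (cvec -` (T ` B))"
    by (subst emeasure_distr) auto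
  also have "\<dots> = emeasure lborel (T ` B)"
    by (subst distr_cvec [symmetric], subst emeasure_distr) auto
  also have "\<dots> = emeasure lebesgue (T ` B)"
    by simp
  also have "\<dots> = emeasure lebesgue B"
    using TB B by (simp only: emeasure_eq_measure2)
  also have "\<dots> = emeasure lborel B"
    by (simp add: B_def)
  also have "\<dots> = emeasure lborel (cvec -` B)"
    by (subst distr_cvec [symmetric], subst emeasure_distr) (auto simp: B_def)
  also have "\<dots> = (\<Prod>b\<in>Basis. (u - l) \<bullet> b)"
    unfolding vimB using lu by simp
  finally show "emeasure (distr lborel borel ((*) c)) (box l u) = (\<Prod>b\<in>Basis. (u - l) \<bullet> b)" .
qed simp

section \<open>Radial functions on the disc\<close>

lemma unit_disc_borel [measurable]: "\<bbbD> \<in> sets borel"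
  by simp

text \<open>Two measures on the line that are finite and equal on all rays \<open>{x<..}\<close>
  coincide. One side gives the area of an annulus, the other the integral of
  \<open>2 * pi * r\<close>.\<close>

lemma distr_cmod_disc:
  "distr (density lborel (indicator \<bbbD>)) borel cmod =
     density lborel (\<lambda>r. ennreal (2 * pi * r) * indicator {0<..<1} r)"
proof (rule measure_eqI_lessThan)
  let ?M = "distr (density lborel (indicator \<bbbD> :: complex \<Rightarrow> ennreal)) borel cmod"
  let ?N = "density lborel (\<lambda>r. ennreal (2 * pi * r) * indicator {0<..<1::real} r)"
  \<comment> \<open>Clamping \<open>x\<close> to \<open>[0, 1]\<close> lets the single formula
    \<open>pi * (1 - (m x)\<^sup>2)\<close> cover all rays.\<close>
  define m where "m x = (if x < 0 then 0 else if x < 1 then x else 1)" for x :: real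
  have m: "0 \<le> m x" "m x \<le> 1" for x
    by (auto simp: m_def)
  have M: "emeasure ?M {x<..} = ennreal (pi * (1 - (m x)\<^sup>2))" for x
  proof -
    have "emeasure ?M {x<..} = emeasure lborel ((\<bbbD>::complex set) \<inter> (cmod -` {x<..}))"
    proof -
      have "cmod -` {x<..} \<in> sets borel"
        by (rule measurable_sets_borel[of cmod borel]) auto
      then show ?thesis
        by (subst emeasure_distr) (auto simp: emeasure_density indicator_inter_arith [symmetric])
    qed
    \<comment> \<open>Negative \<open>x\<close> is separate because \<open>cball 0 0\<close> is the
      origin, which must not be removed in that case.\<close>
    also have "\<bbbD> \<inter> (cmod -` {x<..}) = (if x < 0 then \<bbbD> else \<bbbD> - cball 0 (m x))"
      by (auto simp: m_def intro: less_le_trans[OF _ norm_ge_zero])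
    also have "emeasure lborel \<dots> = ennreal (pi * (1 - (m x)\<^sup>2))"
    proof (cases "x < 0")
      case True
      then show ?thesis
        by (simp add: emeasure_ball m_def unit_ball_vol_2)
    next
      case False
      have "emeasure lborel (\<bbbD> - cball 0 (m x)) = emeasure lborel (ball (0::complex) 1) - emeasure lborel (\<bbbD> \<inter> cball (0::complex) (m x))"
      proof -
        have "emeasure lborel (\<bbbD> \<inter> cball (0::complex) (m x)) \<le> emeasure lborel (\<bbbD> :: complex set)"
          by (intro emeasure_mono) auto
        then have "emeasure lborel (\<bbbD> \<inter> cball (0::complex) (m x)) \<noteq> \<infinity>"
          using emeasure_lborel_ball_finite[of "0::complex" 1] by (auto simp: top_unique)
        then show ?thesis
          by (subst emeasure_Diff [symmetric]) (auto intro!: arg_cong[where f = "emeasure lborel"])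
      qed
      also have "emeasure lborel (\<bbbD> \<inter> cball (0::complex) (m x)) = ennreal (pi * (m x)\<^sup>2)"
      proof (cases "x < 1")
        case True
        with False have "\<bbbD> \<inter> cball (0::complex) (m x) = cball 0 (m x)"
          by (auto simp: m_def)
        then show ?thesis using m[of x] by (simp add: emeasure_cball unit_ball_vol_2)
      next
        case x: False
        then have "\<bbbD> \<inter> cball (0::complex) (m x) = ball 0 1"
          by (auto simp: m_def)
        then show ?thesis using x by (simp add: emeasure_ball unit_ball_vol_2 m_def)
      qed
      finally show ?thesis
        using False by (simp add: emeasure_ball unit_ball_vol_2 ennreal_minus right_diff_distrib)
    qed
    finally show ?thesis .
  qed
  show "emeasure ?M {x<..} < \<infinity>" for x
    by (simp add: M)
  show "emeasure ?M {x<..} = emeasure ?N {x<..}" for x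
  proof -
    have "emeasure ?N {x<..} = (\<integral>\<^sup>+r. ennreal (2 * pi * r) * indicator {0<..<1} r * indicator {x<..} r \<partial>lborel)"
      by (subst emeasure_density) auto
    also have "\<dots> = (\<integral>\<^sup>+r. ennreal (2 * pi * r) * indicator {m x..1} r \<partial>lborel)"
      by (rule nn_integral_cong_AE)
         (use AE_lborel_singleton[of 0] AE_lborel_singleton[of 1] AE_lborel_singleton[of x] in
           \<open>eventually_elim, auto simp: m_def split: split_indicator\<close>)
    also have "\<dots> = ennreal (pi * 1\<^sup>2 - pi * (m x)\<^sup>2)"
      using m[of x]
      by (intro nn_integral_FTC_Icc[where F = "\<lambda>r. pi * r\<^sup>2"]) (auto intro!: derivative_eq_intros)
    finally show ?thesis
      by (simp add: M right_diff_distrib)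
  qed
qed auto

lemma nn_integral_radial_borel:
  assumes [measurable]: "B \<in> borel_measurable borel"
  shows "(\<integral>\<^sup>+ z. B (cmod z) * indicator \<bbbD> z \<partial>lborel) =
    ennreal (2 * pi) * (\<integral>\<^sup>+ r. ennreal r * B r * indicator {0<..<1} r \<partial>lborel)"
proof -
  have "(\<integral>\<^sup>+ z. B (cmod z) * indicator \<bbbD> z \<partial>lborel) =
      (\<integral>\<^sup>+ r. B r \<partial>distr (density lborel (indicator \<bbbD>)) borel cmod)"
  proof -
    have "(\<lambda>z. B (cmod z)) \<in> borel_measurable borel"
      by measurable
    then show ?thesis
      by (subst nn_integral_distr, simp, simp) (subst nn_integral_density, auto simp: mult.commute)
  qed
  also have "\<dots> = (\<integral>\<^sup>+ r. ennreal (2 * pi) * (ennreal r * B r * indicator {0<..<1} r) \<partial>lborel)"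
    unfolding distr_cmod_disc
    by (subst nn_integral_density)
       (auto intro!: nn_integral_cong simp: ennreal_mult mult_ac split: split_indicator)
  finally show ?thesis
    by (simp add: nn_integral_cmult)
qed

text \<open>The indicator of failure has integral zero on the disc exactly when it does on the
  radius, since the density \<open>2 * pi * r\<close> is positive on
  \<open>{0<..<1}\<close>.\<close>

lemma AE_radial_borel:
  assumes [measurable]: "Measurable.pred borel P"
  shows "(AE z in lborel. z \<in> \<bbbD> \<longrightarrow> P (cmod z)) \<longleftrightarrow> (AE r in lborel. r \<in> {0<..<1} \<longrightarrow> P r)"
proof -
  let ?B = "\<lambda>r::real. if P r then 0 else (1::ennreal)"
  have "(AE z in lborel. z \<in> \<bbbD> \<longrightarrow> P (cmod z)) \<longleftrightarrow>
      (\<integral>\<^sup>+ z. ?B (cmod z) * indicator \<bbbD> z \<partial>lborel) = 0"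
  proof (subst nn_integral_0_iff_AE)
    show "(\<lambda>z. ?B (cmod z) * indicator \<bbbD> z) \<in> borel_measurable lborel"
      by measurable
  qed (auto intro!: AE_cong split: split_indicator)
  also have "\<dots> \<longleftrightarrow> (\<integral>\<^sup>+ r. ennreal r * ?B r * indicator {0<..<1} r \<partial>lborel) = 0"
  proof (subst nn_integral_radial_borel)
    have "ennreal (2 * pi) \<noteq> 0"
      using pi_gt_zero by (simp add: ennreal_eq_0_iff not_le)
    then show "(ennreal (2 * pi) * (\<integral>\<^sup>+ r. ennreal r * ?B r * indicator {0<..<1} r \<partial>lborel) = 0) =
        ((\<integral>\<^sup>+ r. ennreal r * ?B r * indicator {0<..<1} r \<partial>lborel) = 0)"
      by simp
  qed auto
  also have "\<dots> \<longleftrightarrow> (AE r in lborel. r \<in> {0<..<1} \<longrightarrow> P r)"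
    by (subst nn_integral_0_iff_AE) (auto intro!: AE_cong simp: ennreal_eq_0_iff split: split_indicator)
  finally show ?thesis .
qed

text \<open>
  Radial slices of Lebesgue measurable sets are Lebesgue measurable: exhaust the set and its
  complement by compact sets up to null sets and take moduli of these compact sets.
\<close>

lemma lebesgue_radial_profile:
  assumes "{z \<in> \<bbbD>. cmod z \<in> E} \<in> sets lebesgue"
  shows "E \<inter> {0<..<1} \<in> sets lebesgue"
proof -
  have D: "\<bbbD> - {0} \<in> sets (lebesgue :: complex measure)"
    by (intro sets_completionI_sets) auto
  \<comment> \<open>If the modulus of \<open>z\<close> lies in \<open>A\<close> but is not attained
    on the sigma-compact part \<open>C\<close>, then \<open>z\<close> itself is outside
    \<open>C\<close>, hence in the null set \<open>T\<close>. Deleting the origin puts the moduli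
    into \<open>{0<..<1}\<close>.\<close>
  have core: "\<exists>U. U \<in> sets borel \<and> U \<subseteq> A \<inter> {0<..<1} \<and>
      {z \<in> \<bbbD> - {0}. cmod z \<in> A - U} \<in> null_sets lebesgue"
    if A: "{z \<in> \<bbbD> - {0}. cmod z \<in> A} \<in> sets lebesgue" for A
  proof -
    obtain C T where CT: "fsigma C" "T \<in> null_sets lebesgue" "C \<union> T = {z \<in> \<bbbD> - {0}. cmod z \<in> A}"
      using lebesgue_set_almost_fsigma[OF A] by metis
    then obtain F :: "nat \<Rightarrow> complex set" where F: "range F \<subseteq> Collect compact" "C = \<Union>(range F)"
      using fsigma_Union_compact by metis
    have cmp: "compact (cmod ` F i)" for i
      using F(1) by (intro compact_continuous_image continuous_intros) auto
    have "cmod ` C = (\<Union>i. cmod ` F i)"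
      unfolding F(2) by (rule image_UN)
    then have "cmod ` C \<in> sets borel"
      using sets.countable_UN[of "\<lambda>i. cmod ` F i" UNIV borel] borel_compact[OF cmp] by auto
    moreover have "{z \<in> \<bbbD> - {0}. cmod z \<in> A - cmod ` C} \<in> null_sets lebesgue"
    proof -
      have *: "{z \<in> \<bbbD> - {0}. cmod z \<in> A - cmod ` C} \<subseteq> T"
      proof
        fix z
        assume "z \<in> {z \<in> \<bbbD> - {0}. cmod z \<in> A - cmod ` C}"
        then have "z \<in> {z \<in> \<bbbD> - {0}. cmod z \<in> A}" "z \<notin> C"
          by blast+
        then show "z \<in> T"
          using CT(3) by (metis UnE)
      qed
      show ?thesis
        by (rule completion.complete2[OF * CT(2)])
    qed
    moreover have "C \<subseteq> {z \<in> \<bbbD> - {0}. cmod z \<in> A}"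
      by (subst CT(3) [symmetric]) (rule Un_upper1)
    then have "cmod ` C \<subseteq> A \<inter> {0<..<1}"
      by auto
    ultimately show ?thesis by blast
  qed
  have "{z \<in> \<bbbD> - {0}. cmod z \<in> E} = {z \<in> \<bbbD>. cmod z \<in> E} \<inter> (\<bbbD> - {0})"
    by auto
  then have E: "{z \<in> \<bbbD> - {0}. cmod z \<in> E} \<in> sets lebesgue"
    using sets.Int[OF assms D] by (simp only:)
  have "{z \<in> \<bbbD> - {0}. cmod z \<in> - E} = (\<bbbD> - {0}) - {z \<in> \<bbbD> - {0}. cmod z \<in> E}"
    by auto
  then have E': "{z \<in> \<bbbD> - {0}. cmod z \<in> - E} \<in> sets lebesgue"
    using sets.Diff[OF D E] by (simp only:)
  obtain U where U: "U \<in> sets borel" "U \<subseteq> E \<inter> {0<..<1}"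
      "{z \<in> \<bbbD> - {0}. cmod z \<in> E - U} \<in> null_sets lebesgue"
    using core[OF E] by blast
  obtain V where V: "V \<in> sets borel" "V \<subseteq> - E \<inter> {0<..<1}"
      "{z \<in> \<bbbD> - {0}. cmod z \<in> - E - V} \<in> null_sets lebesgue"
    using core[OF E'] by blast
  note [measurable] = U(1) V(1)
  \<comment> \<open>Here the complement of \<open>E\<close> pays off: \<open>U \<union> V\<close> is
    Borel, so its exceptional radii can be transferred from the disc to the line, whereas
    \<open>E - U\<close> alone is not yet known to be measurable.\<close>
  have "AE z in lebesgue. z \<in> \<bbbD> \<longrightarrow> cmod z \<in> U \<union> V"
  proof -
    have "AE z in lebesgue. z \<noteq> (0::complex)"
      using AE_lborel_singleton AE_completion by blast
    with AE_not_in[OF U(3)] AE_not_in[OF V(3)] show ?thesis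
      by eventually_elim auto
  qed
  then have "AE z in lborel. z \<in> \<bbbD> \<longrightarrow> cmod z \<in> U \<union> V"
    by (simp add: AE_completion_iff)
  then have "AE r in lborel. r \<in> {0<..<1} \<longrightarrow> r \<in> U \<union> V"
    by (subst (asm) AE_radial_borel) auto
  then have "{0<..<1} - (U \<union> V) \<in> null_sets lborel"
    by (subst (asm) AE_iff_null) (auto simp: set_diff_eq)
  then have null: "E \<inter> ({0<..<1} - (U \<union> V)) \<in> null_sets lebesgue"
    by (intro completion.complete2[OF Int_lower2] null_sets_completionI)
  have "E \<inter> {0<..<1} = U \<union> E \<inter> ({0<..<1} - (U \<union> V))"
    using U(2) V(2) by blast
  also have "\<dots> \<in> sets lebesgue"
    by (intro sets.Un sets_completionI_sets null_setsD2[OF null]) (simp add: U(1))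
  finally show ?thesis .
qed

text \<open>Arbitrary \<open>P\<close> are allowed because the exceptional radii lie in a Borel null
  set. The origin, whose modulus is outside \<open>{0<..<1}\<close>, is discarded
  separately.\<close>

lemma AE_radialI:
  assumes "AE r in lborel. r \<in> {0<..<1} \<longrightarrow> P r"
  shows "AE z in lborel. z \<in> \<bbbD> \<longrightarrow> P (cmod z)"
proof -
  obtain N where N: "{r \<in> space lborel. \<not> (r \<in> {0<..<1} \<longrightarrow> P r)} \<subseteq> N" "N \<in> null_sets lborel"
    using assms by (auto simp: eventually_ae_filter)
  then have [measurable]: "N \<in> sets borel" by auto
  have "AE r in lborel. r \<in> {0<..<1} \<longrightarrow> r \<notin> N"
    using AE_not_in[OF N(2)] by eventually_elim auto
  then have "AE z in lborel. z \<in> \<bbbD> \<longrightarrow> cmod z \<notin> N"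
    by (subst AE_radial_borel) auto
  moreover have "AE z in lborel. z \<noteq> (0::complex)"
    by (rule AE_lborel_singleton)
  ultimately show ?thesis
    by eventually_elim (use N(1) in \<open>auto simp flip: zero_less_norm_iff\<close>)
qed

section \<open>Normalized area measure and Borel profiles of radial functions\<close>

lemma space_disc_area [simp]: "space disc_area = \<bbbD>"
  by (simp add: disc_area_def)

lemma sets_disc_area [measurable_cong, simp]: "sets disc_area = sets (lebesgue_on \<bbbD>)"
  by (simp add: disc_area_def)

lemma unit_disc_lebesgue [simp, measurable]: "\<bbbD> \<in> sets lebesgue"
  by (simp add: sets_completionI_sets)

lemma measurable_disc_area_borel:
  assumes "f \<in> measurable borel N"
  shows "f \<in> measurable disc_area N"
proof -
  have "f \<in> measurable (lebesgue_on \<bbbD>) N"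
    using assms by (intro measurable_restrict_space1 measurable_completion) simp
  then show ?thesis
    by (simp cong: measurable_cong_sets)
qed

lemma AE_disc_area: "(AE z in disc_area. P z) \<longleftrightarrow> (AE z in lborel. z \<in> \<bbbD> \<longrightarrow> P z)"
proof -
  have "ennreal (1 / pi) > 0"
    using pi_gt_zero by simp
  then have "(AE z in disc_area. P z) \<longleftrightarrow> (AE z in lebesgue_on \<bbbD>. P z)"
    unfolding disc_area_def by (subst AE_density) auto
  also have "\<dots> \<longleftrightarrow> (AE z in lebesgue. z \<in> \<bbbD> \<longrightarrow> P z)"
    by (rule AE_restrict_space_iff) simp
  finally show ?thesis by (simp add: AE_completion_iff)
qed

lemma nn_integral_disc_area:
  assumes "f \<in> borel_measurable disc_area"
  shows "(\<integral>\<^sup>+ z. f z \<partial>disc_area) = ennreal (1 / pi) * (\<integral>\<^sup>+ z. f z * indicator \<bbbD> z \<partial>lborel)"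
proof -
  have [measurable]: "f \<in> borel_measurable (lebesgue_on \<bbbD>)"
    using assms by (simp cong: measurable_cong_sets)
  show ?thesis
    unfolding disc_area_def
    by (subst nn_integral_density)
       (auto simp: nn_integral_cmult nn_integral_restrict_space nn_integral_completion)
qed

lemma integral_disc_area_borel:
  fixes f :: "complex \<Rightarrow> complex"
  assumes [measurable]: "f \<in> borel_measurable borel"
  shows "(\<integral> z. f z \<partial>disc_area) = (1 / pi) *\<^sub>R (\<integral> z. indicator \<bbbD> z *\<^sub>R f z \<partial>lborel)"
proof -
  have "f \<in> borel_measurable (lebesgue_on \<bbbD>)"
    by (intro measurable_restrict_space1 measurable_completion) simp
  then have "(\<integral> z. f z \<partial>disc_area) = (1 / pi) *\<^sub>R (\<integral> z. f z \<partial>lebesgue_on \<bbbD>)"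
    unfolding disc_area_def by (subst integral_density) auto
  also have "(\<integral> z. f z \<partial>lebesgue_on \<bbbD>) = (\<integral> z. indicator \<bbbD> z *\<^sub>R f z \<partial>lebesgue)"
    by (subst integral_restrict_space) auto
  also have "\<dots> = (\<integral> z. indicator \<bbbD> z *\<^sub>R f z \<partial>lborel)"
    by (rule integral_completion) measurable
  finally show ?thesis .
qed

text \<open>Serves to make bounded measurable functions integrable, such as the truncated integrand
  built from the dual weight.\<close>

interpretation disc_area: finite_measure disc_area
proof
  have "emeasure disc_area (space disc_area) = (\<integral>\<^sup>+ z. 1 \<partial>disc_area)"
    by simp
  also have "\<dots> \<noteq> \<infinity>"
    by (subst nn_integral_disc_area)
       (auto simp: ennreal_mult_eq_top_iff emeasure_lborel_ball_finite less_top[symmetric] emeasure_ball)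
  finally show "emeasure disc_area (space disc_area) \<noteq> \<infinity>" .
qed

text \<open>A superlevel set of a radial function is a condition on the modulus, so its radial slice
  is Lebesgue measurable; a measurable profile then has a Borel version. Agreement is recorded on
  the disc and on the radius because integrals over both are compared.\<close>

lemma radial_representative:
  fixes h :: "complex \<Rightarrow> ennreal"
  assumes h: "h \<in> borel_measurable disc_area" and radial: "\<And>z. z \<in> \<bbbD> \<Longrightarrow> h z = h (of_real (cmod z))"
  obtains H where "H \<in> borel_measurable borel" "AE z in disc_area. h z = H (cmod z)"
    "AE r in lborel. r \<in> {0<..<1} \<longrightarrow> h (of_real r) = H r"
proof -
  \<comment> \<open>The slice lemma controls only radii in \<open>{0<..<1}\<close>. The value 0
    elsewhere never exceeds \<open>a\<close> in \<open>ennreal\<close>, so the superlevel sets are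
    exactly the slices.\<close>
  define H0 where "H0 r = h (of_real r) * indicator {0<..<1} r" for r :: real
  have "H0 \<in> borel_measurable lebesgue"
  proof (rule borel_measurableI_greater)
    fix a
    have "{z \<in> \<bbbD>. h z > a} \<in> sets (lebesgue_on \<bbbD>)"
      using measurable_sets[OF h, of "{a<..}"] by (simp add: vimage_def Int_def conj_commute)
    then have "{z \<in> \<bbbD>. h z > a} \<in> sets lebesgue"
      by (simp add: sets_restrict_space_iff)
    also have "{z \<in> \<bbbD>. h z > a} = {z \<in> \<bbbD>. cmod z \<in> {r. h (of_real r) > a}}"
      by (intro Collect_cong) (metis radial mem_Collect_eq)
    finally have "{r. h (of_real r) > a} \<inter> {0<..<1} \<in> sets lebesgue"
      by (rule lebesgue_radial_profile)
    also have "{r. h (of_real r) > a} \<inter> {0<..<1} = {r. H0 r > a}"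
      by (auto simp: H0_def split: split_indicator_asm)
    finally show "{r \<in> space lebesgue. a < H0 r} \<in> sets lebesgue"
      by simp
  qed
  then obtain H where H: "H \<in> borel_measurable lborel" "AE r in lborel. H0 r = H r"
    using completion_ex_borel_measurable by blast
  have 1: "AE r in lborel. r \<in> {0<..<1} \<longrightarrow> h (of_real r) = H r"
    using H(2) by eventually_elim (auto simp: H0_def)
  have "AE z in disc_area. h z = H (cmod z)"
    unfolding AE_disc_area using AE_radialI[OF 1] by eventually_elim (metis radial)
  with 1 H(1) that show ?thesis by simp
qed

text \<open>The Jacobian contributes \<open>2 * pi * r\<close> and the normalization
  \<open>1 / pi\<close>, which leaves the factor 2.\<close>

lemma nn_integral_radial:
  fixes h :: "complex \<Rightarrow> ennreal"
  assumes h: "h \<in> borel_measurable disc_area" and radial: "\<And>z. z \<in> \<bbbD> \<Longrightarrow> h z = h (of_real (cmod z))"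
  shows "(\<integral>\<^sup>+ z. h z \<partial>disc_area) = 2 * (\<integral>\<^sup>+ r\<in>{0<..<1}. ennreal r * h (of_real r) \<partial>lebesgue)"
proof -
  obtain H where H [measurable]: "H \<in> borel_measurable borel" and ae: "AE z in disc_area. h z = H (cmod z)"
      "AE r in lborel. r \<in> {0<..<1} \<longrightarrow> h (of_real r) = H r"
    using radial_representative[OF assms] by blast
  have "(\<integral>\<^sup>+ z. h z \<partial>disc_area) = (\<integral>\<^sup>+ z. H (cmod z) \<partial>disc_area)"
    by (rule nn_integral_cong_AE) (rule ae)
  also have "\<dots> = ennreal (1 / pi) * (\<integral>\<^sup>+ z. H (cmod z) * indicator \<bbbD> z \<partial>lborel)"
    by (rule nn_integral_disc_area) (intro measurable_disc_area_borel, measurable)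
  also have "\<dots> = ennreal (1 / pi) * (ennreal (2 * pi) * (\<integral>\<^sup>+ r. ennreal r * H r * indicator {0<..<1} r \<partial>lborel))"
    by (subst nn_integral_radial_borel) auto
  also have "\<dots> = 2 * (\<integral>\<^sup>+ r. ennreal r * H r * indicator {0<..<1} r \<partial>lborel)"
    by (subst mult.assoc [symmetric], subst ennreal_mult [symmetric]) auto
  also have "(\<integral>\<^sup>+ r. ennreal r * H r * indicator {0<..<1} r \<partial>lborel) =
      (\<integral>\<^sup>+ r\<in>{0<..<1}. ennreal r * h (of_real r) \<partial>lborel)"
    by (rule nn_integral_cong_AE) (use ae(2) in \<open>eventually_elim, auto split: split_indicator\<close>)
  finally show ?thesis
    by (simp add: nn_integral_completion)
qed

text \<open>The exponent drops by one because the Jacobian supplies one power of the radius.\<close>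

lemma moment_eq_disc_integral:
  fixes h :: "complex \<Rightarrow> ennreal"
  assumes h [measurable]: "h \<in> borel_measurable disc_area"
    and radial: "\<And>z. z \<in> \<bbbD> \<Longrightarrow> h z = h (of_real (cmod z))"
  shows "(\<integral>\<^sup>+ z. ennreal (cmod z powr (x - 1)) * h z \<partial>disc_area) = 2 * moment h x"
proof -
  have [measurable]: "cmod \<in> borel_measurable disc_area"
    by (rule measurable_disc_area_borel) simp
  have "(\<integral>\<^sup>+ z. ennreal (cmod z powr (x - 1)) * h z \<partial>disc_area) =
      2 * (\<integral>\<^sup>+ r\<in>{0<..<1}. ennreal r * (ennreal (cmod (of_real r) powr (x - 1)) * h (of_real r)) \<partial>lebesgue)"
  proof (rule nn_integral_radial)
    show "ennreal (cmod z powr (x - 1)) * h z =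
        ennreal (cmod (of_real (cmod z)) powr (x - 1)) * h (of_real (cmod z))" if "z \<in> \<bbbD>" for z
      by (subst radial[OF that]) simp
  qed measurable
  also have "(\<integral>\<^sup>+ r\<in>{0<..<1}. ennreal r * (ennreal (cmod (of_real r) powr (x - 1)) * h (of_real r)) \<partial>lebesgue) = moment h x"
    unfolding moment_def
  proof (rule nn_integral_cong)
    fix r :: real
    have "ennreal r * ennreal (r powr (x - 1)) = ennreal (r powr x)" if "0 < r"
      using that by (simp add: ennreal_mult [symmetric] powr_mult_base)
    then show "ennreal r * (ennreal (cmod (of_real r) powr (x - 1)) * h (of_real r)) * indicator {0<..<1} r =
        ennreal (r powr x) * h (of_real r) * indicator {0<..<1} r"
      by (auto simp: mult.assoc [symmetric] split: split_indicator)
  qed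
  finally show ?thesis .
qed

text \<open>A suitable rotation changes the sign of the integrand, so the integral equals its own
  negative. The hypotheses are weaker than \<open>radial_weight\<close> so that the lemma also
  applies to weights cut off near the circle, whose tails vanish.\<close>

lemma integral_monomials_orthogonal:
  fixes h :: "complex \<Rightarrow> real"
  assumes h [measurable]: "h \<in> borel_measurable disc_area"
    and radial: "\<And>z. z \<in> \<bbbD> \<Longrightarrow> h z = h (of_real (cmod z))"
    and nonneg: "\<And>z. z \<in> \<bbbD> \<Longrightarrow> 0 \<le> h z"
    and "n \<noteq> k"
  shows "(\<integral> z. z ^ n * cnj z ^ k * of_real (h z) \<partial>disc_area) = 0"
proof -
  obtain H where H [measurable]: "H \<in> borel_measurable borel" and ae: "AE z in disc_area. ennreal (h z) = H (cmod z)"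
  proof (rule radial_representative[of "\<lambda>z. ennreal (h z)"])
    show "ennreal (h z) = ennreal (h (of_real (cmod z)))" if "z \<in> \<bbbD>" for z
      by (subst radial[OF that]) simp
  qed auto
  \<comment> \<open>Rotation invariance is available for \<open>lborel\<close>, so the integrand is
    replaced by a Borel one that is still a function of \<open>z\<close> through \<open>z\<close>,
    \<open>cnj z\<close> and \<open>cmod z\<close>.\<close>
  define F where "F z = z ^ n * cnj z ^ k * of_real (enn2real (H (cmod z)))" for z
  have [measurable]: "cnj \<in> borel_measurable borel"
    by (intro borel_measurable_continuous_onI continuous_intros)
  have F [measurable]: "F \<in> borel_measurable borel"
    unfolding F_def by measurable
  note [measurable] = measurable_disc_area_borel[OF F] measurable_disc_area_borel[of cnj borel]
     measurable_disc_area_borel[of "\<lambda>z. z" borel]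
  have "(\<integral> z. z ^ n * cnj z ^ k * of_real (h z) \<partial>disc_area) = (\<integral> z. F z \<partial>disc_area)"
  proof (rule integral_cong_AE)
    show "AE z in disc_area. z ^ n * cnj z ^ k * of_real (h z) = F z"
      using ae AE_space
    proof eventually_elim
      case (elim z)
      then have "h z = enn2real (H (cmod z))"
        using nonneg by (metis enn2real_ennreal space_disc_area)
      then show ?case by (simp add: F_def)
    qed
  qed measurable
  also have "\<dots> = (1 / pi) *\<^sub>R (\<integral> z. indicator \<bbbD> z *\<^sub>R F z \<partial>lborel)"
    by (rule integral_disc_area_borel) (rule F)
  also have "(\<integral> z. indicator \<bbbD> z *\<^sub>R F z \<partial>lborel) = 0"
  proof -
    let ?I = "\<integral> z. indicator \<bbbD> z *\<^sub>R F z \<partial>lborel"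
    \<comment> \<open>The angle is chosen so that \<open>(n - k)\<close> times it is
      \<open>pi\<close>; the difference is taken in the reals, so \<open>n < k\<close> is covered
      too.\<close>
    define c where "c = cis (pi / (real n - real k))"
    have c: "c ^ n * cnj c ^ k = -1"
    proof -
      have "c ^ n * cnj c ^ k = cis (real n * (pi / (real n - real k))) * cis (real k * - (pi / (real n - real k)))"
        by (simp only: c_def cis_cnj Complex.DeMoivre)
      also have "\<dots> = cis (real n * (pi / (real n - real k)) + real k * - (pi / (real n - real k)))"
        by (rule cis_mult)
      also have "real n * (pi / (real n - real k)) + real k * - (pi / (real n - real k)) = pi"
      proof -
        have "real n * (pi / (real n - real k)) + real k * - (pi / (real n - real k)) =
            (real n - real k) * (pi / (real n - real k))"
          by (simp only: left_diff_distrib mult_minus_right diff_conv_add_uminus [symmetric])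
        then show ?thesis using \<open>n \<noteq> k\<close> by simp
      qed
      finally show ?thesis by simp
    qed
    have 1: "cmod c = 1" by (simp add: c_def)
    have F_rot: "F (c * z) = - F z" for z
    proof -
      have "F (c * z) = (c ^ n * cnj c ^ k) * F z"
        unfolding F_def norm_mult 1 by (simp add: power_mult_distrib mult_ac)
      then show ?thesis by (simp add: c)
    qed
    have D_rot: "indicator \<bbbD> (c * z) = (indicator \<bbbD> z :: real)" for z
      using 1 by (auto simp: norm_mult split: split_indicator)
    have "?I = (\<integral> z. indicator \<bbbD> z *\<^sub>R F z \<partial>distr lborel borel ((*) c))"
      by (simp only: lborel_complex_rotate[OF 1])
    also have "\<dots> = (\<integral> z. indicator \<bbbD> (c * z) *\<^sub>R F (c * z) \<partial>lborel)"
    proof (rule integral_distr)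
      show "(*) c \<in> measurable lborel borel"
        by simp
      show "(\<lambda>z. indicator \<bbbD> z *\<^sub>R F z) \<in> borel_measurable borel"
        by (intro borel_measurable_scaleR borel_measurable_indicator F) simp
    qed
    also have "\<dots> = - ?I"
      by (simp only: F_rot D_rot scaleR_minus_right integral_minus)
    finally have "?I + ?I = 0"
      by (rule eq_neg_iff_add_eq_0 [THEN iffD1])
    moreover have "x = 0" if "x + x = 0" for x :: complex
      using that by (simp add: complex_eq_iff)
    ultimately show ?thesis by blast
  qed
  finally show ?thesis by simp
qed

lemma borel_measurable_disc_areaI:
  fixes f :: "complex \<Rightarrow> 'a::euclidean_space"
  assumes "continuous_on \<bbbD> f"
  shows "f \<in> borel_measurable disc_area"
proof -
  have "f \<in> borel_measurable (lebesgue_on \<bbbD>)"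
    by (rule continuous_imp_measurable_on_sets_lebesgue[OF assms]) simp
  then show ?thesis by (simp cong: measurable_cong_sets)
qed

lemma norm_disc_area_measurable [measurable]: "cmod \<in> borel_measurable disc_area"
  and ident_disc_area_measurable [measurable]: "(\<lambda>z. z) \<in> borel_measurable disc_area"
  and cnj_disc_area_measurable [measurable]: "cnj \<in> borel_measurable disc_area"
  by (intro borel_measurable_disc_areaI continuous_intros)+

lemma enn_powr_less_top_iff [simp]: "enn_powr x a < top \<longleftrightarrow> x < top"
  by (auto simp: enn_powr_def top.not_eq_extremum)

lemma power_disc_le_1: "z \<in> \<bbbD> \<Longrightarrow> cmod z ^ n \<le> 1"
  by (rule power_le_one) auto

section \<open>The Bergman kernel of a radial weight\<close>

text \<open>Termwise integration under the majorant \<open>C k * norm (u x)\<close>. The bound is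
  demanded only where \<open>u\<close> is nonzero, so that a \<open>u\<close> supported in a smaller
  disc suffices when the series converges badly near the circle.\<close>

lemma integral_series:
  fixes u :: "'a \<Rightarrow> complex"
  assumes u: "integrable M u"
    and \<phi>: "\<And>k::nat. \<phi> k \<in> borel_measurable M"
    and bound: "\<And>k x. x \<in> space M \<Longrightarrow> u x \<noteq> 0 \<Longrightarrow> cmod (\<phi> k x) \<le> C k"
    and C: "summable C" "\<And>k. 0 \<le> C k"
  shows "(\<lambda>k. \<integral>x. \<phi> k x * u x \<partial>M) sums (\<integral>x. (\<Sum>k. \<phi> k x) * u x \<partial>M)"
proof -
  have [measurable]: "u \<in> borel_measurable M" using u by simp
  note [measurable] = \<phi>
  have le: "norm (\<phi> k x * u x) \<le> C k * norm (u x)" if "x \<in> space M" for k x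
    using bound[OF that] C(2) by (cases "u x = 0") (auto simp: norm_mult intro: mult_right_mono)
  have int: "integrable M (\<lambda>x. \<phi> k x * u x)" for k
  proof (rule Bochner_Integration.integrable_bound)
    show "integrable M (\<lambda>x. C k * norm (u x))"
      using u by (intro integrable_mult_right integrable_norm)
    show "AE x in M. norm (\<phi> k x * u x) \<le> norm (C k * norm (u x))"
      using le C(2) by (auto simp: abs_mult intro!: AE_I2)
  qed measurable
  have int_le: "norm (\<integral>x. norm (\<phi> k x * u x) \<partial>M) \<le> C k * (\<integral>x. norm (u x) \<partial>M)" for k
  proof -
    have "(\<integral>x. norm (\<phi> k x * u x) \<partial>M) \<le> (\<integral>x. C k * norm (u x) \<partial>M)"
      using le u int by (intro integral_mono integrable_norm integrable_mult_right)
    then show ?thesis by simp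
  qed
  have "(\<lambda>k. \<integral>x. \<phi> k x * u x \<partial>M) sums (\<integral>x. (\<Sum>k. \<phi> k x * u x) \<partial>M)"
  proof (rule sums_integral)
    show "AE x in M. summable (\<lambda>k. norm (\<phi> k x * u x))"
      by (intro AE_I2 summable_comparison_test[OF _ summable_mult2[OF C(1)]] exI allI impI)
         (use le in auto)
    show "summable (\<lambda>k. \<integral>x. norm (\<phi> k x * u x) \<partial>M)"
      by (intro summable_comparison_test[OF _ summable_mult2[OF C(1)]] exI allI impI) (rule int_le)
  qed (rule int)
  also have "(\<integral>x. (\<Sum>k. \<phi> k x * u x) \<partial>M) = (\<integral>x. (\<Sum>k. \<phi> k x) * u x \<partial>M)"
  proof (rule Bochner_Integration.integral_cong)
    fix x assume x: "x \<in> space M"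
    show "(\<Sum>k. \<phi> k x * u x) = (\<Sum>k. \<phi> k x) * u x"
    proof (cases "u x = 0")
      case False
      then have "summable (\<lambda>k. \<phi> k x)"
        using bound[OF x] C(1) by (intro summable_comparison_test[OF _ C(1)]) auto
      then show ?thesis by (rule suminf_mult2 [symmetric])
    qed simp
  qed simp
  finally show ?thesis .
qed

text \<open>This is \<open>2 * \<omega>_(2n+1)\<close> for the weight \<open>w\<close>, the squared
  norm of \<open>z^n\<close>, kept as a real number so that it can be divided by.\<close>

definition disc_moment :: "(complex \<Rightarrow> real) \<Rightarrow> nat \<Rightarrow> real" where
  "disc_moment w n = (\<integral> z. cmod z ^ (2 * n) * w z \<partial>disc_area)"

definition kernel_series :: "(complex \<Rightarrow> real) \<Rightarrow> complex \<Rightarrow> complex \<Rightarrow> complex" where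
  "kernel_series w z \<zeta> = (\<Sum>n. cnj z ^ n / of_real (disc_moment w n) * \<zeta> ^ n)"

locale disc_weight =
  fixes w :: "complex \<Rightarrow> real"
  assumes radial_weight: "radial_weight w"
begin

section \<open>Positivity and slow decay of the moments; convergence of the kernel series\<close>

lemma weight_integrable: "integrable disc_area w"
  and weight_nonneg: "z \<in> \<bbbD> \<Longrightarrow> 0 \<le> w z"
  and weight_radial: "z \<in> \<bbbD> \<Longrightarrow> w z = w (of_real (cmod z))"
  and weight_measurable [measurable]: "w \<in> borel_measurable disc_area"
  using radial_weight unfolding radial_weight_def by (blast, blast, blast, auto)

lemma integrable_weight_mult:
  fixes g :: "complex \<Rightarrow> 'a::{real_normed_field, euclidean_space}"
  assumes [measurable]: "g \<in> borel_measurable disc_area" and g: "\<And>z. z \<in> \<bbbD> \<Longrightarrow> norm (g z) \<le> B"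
  shows "integrable disc_area (\<lambda>z. g z * of_real (w z))"
proof (rule Bochner_Integration.integrable_bound)
  show "integrable disc_area (\<lambda>z. B * w z)"
    using weight_integrable by simp
  have "norm (g z * of_real (w z)) \<le> norm (B * w z)" if z: "z \<in> \<bbbD>" for z
  proof -
    have "norm (g z) * \<bar>w z\<bar> \<le> B * \<bar>w z\<bar>"
      using g[OF z] by (intro mult_right_mono) auto
    also have "\<dots> \<le> \<bar>B\<bar> * \<bar>w z\<bar>" by (intro mult_right_mono) auto
    finally show ?thesis by (simp add: norm_mult abs_mult)
  qed
  then show "AE z in disc_area. norm (g z * of_real (w z)) \<le> norm (B * w z)"
    by (intro AE_I2) simp
qed measurable

lemma disc_moment_integrable: "integrable disc_area (\<lambda>z. cmod z ^ (2 * n) * w z)"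
  using integrable_weight_mult[of "\<lambda>z. cmod z ^ (2 * n)" 1] power_disc_le_1 by simp

text \<open>The standing tail assumption enters here: zero mass on the annulus would make the Borel
  profile vanish almost everywhere on \<open>{R<..<1}\<close>, hence the tail integral too.\<close>

lemma tail_mass_pos:
  assumes "0 \<le> R" "R < 1"
  shows "(\<integral> z. indicator {z. R < cmod z} z * w z \<partial>disc_area) > 0"
proof -
  have meas [measurable]: "{z. R < cmod z} \<in> sets borel"
    by measurable
  have int: "integrable disc_area (\<lambda>z. indicator {z. R < cmod z} z * w z)"
    using integrable_weight_mult[of "\<lambda>z. indicator {z. R < cmod z} z :: real" 1]
    by (simp add: measurable_disc_area_borel)
  have nn: "AE z in disc_area. 0 \<le> indicator {z. R < cmod z} z * w z"
    using weight_nonneg by (intro AE_I2) auto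
  have "(\<integral> z. indicator {z. R < cmod z} z * w z \<partial>disc_area) \<noteq> 0"
  proof
    assume "(\<integral> z. indicator {z. R < cmod z} z * w z \<partial>disc_area) = 0"
    then have zero: "AE z in disc_area. indicator {z. R < cmod z} z * w z = 0"
      using integral_nonneg_eq_0_iff_AE[OF int nn] by simp
    obtain H where H [measurable]: "H \<in> borel_measurable borel"
      and ae: "AE z in disc_area. ennreal (w z) = H (cmod z)"
      "AE r in lborel. r \<in> {0<..<1} \<longrightarrow> ennreal (w (of_real r)) = H r"
    proof (rule radial_representative[of "\<lambda>z. ennreal (w z)"])
      show "ennreal (w z) = ennreal (w (of_real (cmod z)))" if "z \<in> \<bbbD>" for z
        by (subst weight_radial[OF that]) simp
    qed auto
    have "AE z in disc_area. R < cmod z \<longrightarrow> H (cmod z) = 0"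
      using zero ae(1) by eventually_elim (auto split: split_indicator_asm simp: ennreal_0)
    then have "AE z in lborel. z \<in> \<bbbD> \<longrightarrow> (R < cmod z \<longrightarrow> H (cmod z) = 0)"
      by (simp add: AE_disc_area)
    then have "AE r in lborel. r \<in> {0<..<1} \<longrightarrow> (R < r \<longrightarrow> H r = 0)"
      by (subst (asm) AE_radial_borel) auto
    with ae(2) have "AE r in lborel. ennreal (w (of_real r)) * indicator {R<..<1} r = 0"
      by eventually_elim (use assms in \<open>auto split: split_indicator\<close>)
    then have "(\<integral>\<^sup>+ r\<in>{R<..<1}. ennreal (w (of_real r)) \<partial>lborel) = (\<integral>\<^sup>+ r. 0 \<partial>(lborel :: real measure))"
      by (intro nn_integral_cong_AE)
    then have "(\<integral>\<^sup>+ r\<in>{cmod (of_real R)<..<1}. ennreal (w (of_real r)) \<partial>lebesgue) = 0"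
      using assms by (simp add: nn_integral_completion)
    moreover have "(\<integral>\<^sup>+ r\<in>{cmod (of_real R)<..<1}. ennreal (w (of_real r)) \<partial>lebesgue) > 0"
    proof -
      have "of_real R \<in> \<bbbD>" using assms by simp
      then show ?thesis using radial_weight unfolding radial_weight_def by blast
    qed
    ultimately show False by simp
  qed
  with integral_nonneg_AE[OF nn] show ?thesis by simp
qed

text \<open>On \<open>R < cmod z\<close> the factor is at least \<open>R ^ (2 * n)\<close>, and the
  mass there is positive. As \<open>R\<close> may be close to 1, the moments decay more slowly than
  any geometric sequence.\<close>

lemma disc_moment_lower_bound:
  assumes "0 \<le> R" "R < 1"
  obtains c where "0 < c" "\<And>n. c * R ^ (2 * n) \<le> disc_moment w n"
proof
  let ?c = "\<integral> z. indicator {z. R < cmod z} z * w z \<partial>disc_area"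
  show "0 < ?c" by (rule tail_mass_pos[OF assms])
  show "?c * R ^ (2 * n) \<le> disc_moment w n" for n
  proof -
    have meas [measurable]: "{z. R < cmod z} \<in> sets borel"
      by measurable
    have int: "integrable disc_area (\<lambda>z. indicator {z. R < cmod z} z * w z)"
      using integrable_weight_mult[of "\<lambda>z. indicator {z. R < cmod z} z :: real" 1]
      by (simp add: measurable_disc_area_borel)
    have "(\<integral> z. indicator {z. R < cmod z} z * w z * R ^ (2 * n) \<partial>disc_area) \<le> disc_moment w n"
      unfolding disc_moment_def
    proof (rule integral_mono)
      show "integrable disc_area (\<lambda>z. indicator {z. R < cmod z} z * w z * R ^ (2 * n))"
        using int by simp
      show "integrable disc_area (\<lambda>z. cmod z ^ (2 * n) * w z)"
        by (rule disc_moment_integrable)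
      fix z assume "z \<in> space disc_area"
      then have "0 \<le> w z" using weight_nonneg by simp
      then show "indicator {z. R < cmod z} z * w z * R ^ (2 * n) \<le> cmod z ^ (2 * n) * w z"
        using assms by (auto simp: mult.commute[of "w z"] intro!: mult_right_mono power_mono split: split_indicator)
    qed
    then show ?thesis by simp
  qed
qed

lemma disc_moment_pos: "0 < disc_moment w n"
proof -
  obtain c where "0 < c" "\<And>n. c * (1 / 2) ^ (2 * n) \<le> disc_moment w n"
    using disc_moment_lower_bound[of "1 / 2"] by auto
  then show ?thesis
    by (metis (no_types) half_gt_zero_iff less_le_trans mult_pos_pos zero_less_one zero_less_power)
qed

lemma summable_kernel_coeffs:
  assumes "z \<in> \<bbbD>"
  shows "summable (\<lambda>n. cmod z ^ n / disc_moment w n)"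
proof -
  \<comment> \<open>The square of \<open>R\<close> is the midpoint of \<open>cmod z\<close> and 1,
    so the comparison ratio \<open>cmod z / R\<^sup>2\<close> is below 1.\<close>
  define R where "R = sqrt ((1 + cmod z) / 2)"
  have R: "0 \<le> R" "R < 1" "cmod z < R\<^sup>2"
    using assms by (auto simp: R_def add_nonneg_nonneg)
  obtain c where c: "0 < c" "\<And>n. c * R ^ (2 * n) \<le> disc_moment w n"
    using disc_moment_lower_bound[OF R(1,2)] by auto
  have R2: "0 < R\<^sup>2" using R(3) norm_ge_zero[of z] by linarith
  then have "0 < R" using R(1) by (cases "R = 0") auto
  have geometric: "summable (\<lambda>n. (cmod z / R\<^sup>2) ^ n / c)"
    using R R2 by (intro summable_divide summable_geometric) simp
  have le: "norm (cmod z ^ n / disc_moment w n) \<le> (cmod z / R\<^sup>2) ^ n / c" for n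
  proof -
    have "cmod z ^ n / disc_moment w n \<le> cmod z ^ n / (c * (R\<^sup>2) ^ n)"
      using c(2)[of n] c(1) \<open>0 < R\<close> disc_moment_pos[of n]
      by (intro divide_left_mono mult_pos_pos) (auto simp: power_mult [symmetric])
    then show ?thesis
      using disc_moment_pos[of n] by (simp add: power_divide mult.commute)
  qed
  show ?thesis
    using geometric by (rule summable_comparison_test') (rule le)
qed

lemma kernel_term_le:
  assumes "\<zeta> \<in> \<bbbD>"
  shows "cmod (cnj z ^ n / of_real (disc_moment w n) * \<zeta> ^ n) \<le> cmod z ^ n / disc_moment w n"
proof -
  have "cmod z ^ n / disc_moment w n * cmod \<zeta> ^ n \<le> cmod z ^ n / disc_moment w n * 1"
    using power_disc_le_1[OF assms] disc_moment_pos[of n] by (intro mult_left_mono) auto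
  then show ?thesis
    using disc_moment_pos[of n] by (simp add: norm_mult norm_divide norm_power)
qed

lemma kernel_series_sums:
  assumes "z \<in> \<bbbD>" "\<zeta> \<in> \<bbbD>"
  shows "(\<lambda>n. cnj z ^ n / of_real (disc_moment w n) * \<zeta> ^ n) sums kernel_series w z \<zeta>"
  unfolding kernel_series_def
  by (intro summable_sums summable_comparison_test[OF _ summable_kernel_coeffs[OF assms(1)]])
     (use kernel_term_le[OF assms(2)] in blast)

lemma kernel_series_holomorphic:
  assumes "z \<in> \<bbbD>"
  shows "kernel_series w z holomorphic_on \<bbbD>"
proof (rule power_series_holomorphic)
  fix \<zeta> :: complex
  assume "\<zeta> \<in> ball 0 1"
  then show "(\<lambda>n. cnj z ^ n / of_real (disc_moment w n) * (\<zeta> - 0) ^ n) sums kernel_series w z \<zeta>"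
    using kernel_series_sums[OF assms] by simp
qed

lemma kernel_series_bounded:
  assumes "z \<in> \<bbbD>" "\<zeta> \<in> \<bbbD>"
  shows "cmod (kernel_series w z \<zeta>) \<le> (\<Sum>n. cmod z ^ n / disc_moment w n)"
  unfolding kernel_series_def
  by (rule norm_suminf_le[OF kernel_term_le[OF assms(2)] summable_kernel_coeffs[OF assms(1)]])

lemma bounded_holomorphic_in_bergman_space:
  assumes f: "f holomorphic_on \<bbbD>" and B: "\<And>z. z \<in> \<bbbD> \<Longrightarrow> cmod (f z) \<le> B"
  shows "f \<in> bergman_space 2 w"
proof -
  have [measurable]: "f \<in> borel_measurable disc_area"
    using f by (intro borel_measurable_disc_areaI holomorphic_on_imp_continuous_on)
  have "integrable disc_area (\<lambda>z. cmod (f z) powr 2 * of_real (w z))"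
  proof (rule integrable_weight_mult)
    show "norm (cmod (f z) powr 2) \<le> B powr 2" if "z \<in> \<bbbD>" for z
      using powr_mono2[of 2 "cmod (f z)" B] B[OF that] by simp
  qed measurable
  then have "(\<integral>\<^sup>+ z. ennreal (norm (cmod (f z) powr 2 * w z)) \<partial>disc_area) < \<infinity>"
    by (simp add: integrable_iff_bounded)
  also have "(\<integral>\<^sup>+ z. ennreal (norm (cmod (f z) powr 2 * w z)) \<partial>disc_area) =
      (\<integral>\<^sup>+ z. ennreal (cmod (f z) powr 2 * w z) \<partial>disc_area)"
    using weight_nonneg by (intro nn_integral_cong) (simp add: abs_mult)
  finally show ?thesis
    using f by (simp add: bergman_space_def Lp_space_def Lp_norm_def)
qed

text \<open>Since \<open>w\<close> has finite mass, \<open>t <= t\<^sup>2 + 1\<close> turns square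
  integrability into integrability.\<close>

lemma bergman_space_integrable:
  assumes "f \<in> bergman_space 2 w"
  shows "integrable disc_area (\<lambda>z. f z * of_real (w z))"
proof -
  have [measurable]: "f \<in> borel_measurable disc_area"
    and fin: "(\<integral>\<^sup>+ z. ennreal (cmod (f z) powr 2 * w z) \<partial>disc_area) < \<infinity>"
    using assms by (auto simp: bergman_space_def Lp_space_def Lp_norm_def)
  have "(\<integral>\<^sup>+ z. ennreal (norm (cmod (f z) powr 2 * w z)) \<partial>disc_area) =
      (\<integral>\<^sup>+ z. ennreal (cmod (f z) powr 2 * w z) \<partial>disc_area)"
    using weight_nonneg by (intro nn_integral_cong) (simp add: abs_mult)
  with fin have "integrable disc_area (\<lambda>z. cmod (f z) powr 2 * w z)"
    by (intro integrableI_bounded) auto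
  then have "integrable disc_area (\<lambda>z. cmod (f z) powr 2 * w z + w z)"
    using weight_integrable by simp
  then show ?thesis
  proof (rule Bochner_Integration.integrable_bound)
    have "norm (f z * of_real (w z)) \<le> norm (cmod (f z) powr 2 * w z + w z)" if z: "z \<in> \<bbbD>" for z
    proof -
      have "cmod (f z) \<le> cmod (f z) powr 2 + 1"
      proof -
        have "2 * cmod (f z) \<le> 1 + (cmod (f z))\<^sup>2"
          using zero_le_power2[of "cmod (f z) - 1"] by (simp add: power2_eq_square algebra_simps)
        moreover have "cmod (f z) powr 2 = (cmod (f z))\<^sup>2"
          by simp
        ultimately show ?thesis
          using norm_ge_zero[of "f z"] by linarith
      qed
      then have "cmod (f z) * w z \<le> (cmod (f z) powr 2 + 1) * w z"
        using weight_nonneg[OF z] by (rule mult_right_mono)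
      then show ?thesis
        using weight_nonneg[OF z] by (simp add: norm_mult distrib_right)
    qed
    then show "AE z in disc_area. norm (f z * of_real (w z)) \<le> norm (cmod (f z) powr 2 * w z + w z)"
      by (intro AE_I2) simp
  qed measurable
qed

end

section \<open>Taylor coefficients, the reproducing property and projections of monomials times
  radial functions\<close>

context disc_weight
begin

text \<open>Orthogonality singles out the \<open>n\<close>-th term once sum and integral are
  exchanged. The Taylor series need not be dominated up to the circle, so the exchange is made for
  \<open>w\<close> cut off to smaller discs, and the radius then tends to 1.\<close>

lemma taylor_coeff_integral:
  assumes sums: "\<And>z. z \<in> \<bbbD> \<Longrightarrow> (\<lambda>k. a k * z ^ k) sums f z"
    and f: "integrable disc_area (\<lambda>z. f z * of_real (w z))"
  shows "(\<integral> z. f z * (cnj z ^ n * of_real (w z)) \<partial>disc_area) = a n * of_real (disc_moment w n)"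
proof -
  define R where "R j = 1 + - inverse (real (Suc j))" for j
  have R: "0 \<le> R j" "R j < 1" for j
    by (auto simp: R_def field_simps)
  have Rlim: "R \<longlonglongrightarrow> 1"
    unfolding R_def by (rule LIMSEQ_inverse_real_of_nat_add_minus)
  define h where "h j z = indicator (cball 0 (R j)) z * w z" for j and z :: complex
  have h_meas [measurable]: "h j \<in> borel_measurable disc_area" for j
  proof -
    have [measurable]: "indicator (cball 0 (R j)) \<in> borel_measurable disc_area"
      by (rule measurable_disc_area_borel) (intro borel_measurable_indicator, simp)
    show ?thesis unfolding h_def by measurable
  qed
  have h_radial: "h j z = h j (of_real (cmod z))" if "z \<in> \<bbbD>" for j z
    using weight_radial[OF that] by (simp add: h_def indicator_def)
  have h_nonneg: "0 \<le> h j z" if "z \<in> \<bbbD>" for j z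
    using weight_nonneg[OF that] by (simp add: h_def)
  have h_le: "\<bar>h j z\<bar> \<le> w z" if "z \<in> \<bbbD>" for j z
    using weight_nonneg[OF that] by (auto simp: h_def indicator_def)
  have h_lim: "(\<lambda>j. h j z) \<longlonglongrightarrow> w z" if "z \<in> \<bbbD>" for z
  proof -
    have "\<forall>\<^sub>F j in sequentially. cmod z < R j"
      using order_tendstoD(1)[OF Rlim] that by simp
    then have "\<forall>\<^sub>F j in sequentially. h j z = w z"
      by eventually_elim (simp add: h_def)
    then show ?thesis by (rule tendsto_eventually)
  qed
  have h_int: "integrable disc_area (\<lambda>z. z ^ m * (cnj z ^ n * of_real (h j z)))" for m j
  proof -
    have [measurable]: "indicator (cball 0 (R j)) \<in> borel_measurable disc_area"
      by (rule measurable_disc_area_borel) (intro borel_measurable_indicator, simp)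
    have "integrable disc_area (\<lambda>z. z ^ m * cnj z ^ n * of_real (indicator (cball 0 (R j)) z) * of_real (w z))"
    proof (rule integrable_weight_mult)
      show "cmod (z ^ m * cnj z ^ n * of_real (indicator (cball 0 (R j)) z)) \<le> 1" if "z \<in> \<bbbD>" for z
        using power_disc_le_1[OF that] by (auto simp: norm_mult norm_power mult_le_one indicator_def)
    qed measurable
    then show ?thesis by (simp add: h_def mult_ac)
  qed
  have eq: "(\<integral> z. f z * (cnj z ^ n * of_real (h j z)) \<partial>disc_area) =
      a n * of_real (\<integral> z. cmod z ^ (2 * n) * h j z \<partial>disc_area)" for j
  proof -
    \<comment> \<open>Convergence at one point beyond \<open>R j\<close> makes the series absolutely
      convergent at radius \<open>R j\<close>, which provides the summable majorant.\<close>
    obtain \<rho> where \<rho>: "R j < \<rho>" "\<rho> < 1"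
      using R(2)[of j] dense by blast
    then have "complex_of_real \<rho> \<in> \<bbbD>"
      using R(1)[of j] by simp
    then have "summable (\<lambda>k. a k * of_real \<rho> ^ k)"
      using sums sums_summable by blast
    then have "summable (\<lambda>k. norm (a k * of_real (R j) ^ k))"
      by (rule powser_insidea) (use R[of j] \<rho> in simp)
    then have summ: "summable (\<lambda>k. cmod (a k) * R j ^ k)"
      using R[of j] by (simp add: norm_mult norm_power)
    have "(\<lambda>k. \<integral> z. a k * z ^ k * (cnj z ^ n * of_real (h j z)) \<partial>disc_area) sums
        (\<integral> z. (\<Sum>k. a k * z ^ k) * (cnj z ^ n * of_real (h j z)) \<partial>disc_area)"
    proof (rule integral_series[OF _ _ _ summ])
      show "integrable disc_area (\<lambda>z. cnj z ^ n * of_real (h j z))"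
        using h_int[of 0 j] by simp
      show "cmod (a k * z ^ k) \<le> cmod (a k) * R j ^ k"
        if "cnj z ^ n * complex_of_real (h j z) \<noteq> 0" for k z
      proof -
        have "cmod z \<le> R j" using that by (auto simp: h_def indicator_def split: if_splits)
        then show ?thesis
          by (auto simp: norm_mult norm_power intro!: mult_left_mono power_mono)
      qed
      show "0 \<le> cmod (a k) * R j ^ k" for k
        using R by simp
    qed measurable
    also have "(\<integral> z. (\<Sum>k. a k * z ^ k) * (cnj z ^ n * of_real (h j z)) \<partial>disc_area) =
        (\<integral> z. f z * (cnj z ^ n * of_real (h j z)) \<partial>disc_area)"
      by (rule Bochner_Integration.integral_cong) (use sums in \<open>simp_all add: sums_iff\<close>)
    also have "(\<lambda>k. \<integral> z. a k * z ^ k * (cnj z ^ n * of_real (h j z)) \<partial>disc_area) =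
        (\<lambda>k. if k = n then a n * of_real (\<integral> z. cmod z ^ (2 * n) * h j z \<partial>disc_area) else 0)"
    proof
      fix k
      have "(\<integral> z. a k * z ^ k * (cnj z ^ n * of_real (h j z)) \<partial>disc_area) =
          (\<integral> z. a k * (z ^ k * cnj z ^ n * of_real (h j z)) \<partial>disc_area)"
        by (simp add: mult_ac)
      also have "\<dots> = a k * (\<integral> z. z ^ k * cnj z ^ n * of_real (h j z) \<partial>disc_area)"
        by (rule integral_mult_right_zero)
      also have "(\<integral> z. z ^ k * cnj z ^ n * of_real (h j z) \<partial>disc_area) =
          (if k = n then of_real (\<integral> z. cmod z ^ (2 * n) * h j z \<partial>disc_area) else 0)"
      proof (cases "k = n")
        case True
        have "z ^ n * cnj z ^ n * of_real (h j z) = of_real (cmod z ^ (2 * n) * h j z)" for z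
          by (simp add: power_mult_distrib [symmetric] complex_norm_square [symmetric] power_mult)
        then show ?thesis using True by (simp only: integral_complex_of_real simp_thms if_True)
      next
        case False
        then show ?thesis
          using integral_monomials_orthogonal[OF h_meas h_radial h_nonneg False] by simp
      qed
      finally show "(\<integral> z. a k * z ^ k * (cnj z ^ n * of_real (h j z)) \<partial>disc_area) =
          (if k = n then a n * of_real (\<integral> z. cmod z ^ (2 * n) * h j z \<partial>disc_area) else 0)"
        by simp
    qed
    finally have "(\<lambda>k. if k = n then a n * of_real (\<integral> z. cmod z ^ (2 * n) * h j z \<partial>disc_area) else 0)
        sums (\<integral> z. f z * (cnj z ^ n * of_real (h j z)) \<partial>disc_area)" .
    with sums_single[of n "\<lambda>k. a n * of_real (\<integral> z. cmod z ^ (2 * n) * h j z \<partial>disc_area)"]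
    show ?thesis
      using sums_unique2 by blast
  qed
  have f_meas: "f \<in> borel_measurable disc_area"
  proof (rule borel_measurable_disc_areaI)
    have "f holomorphic_on \<bbbD>"
      using sums by (intro power_series_holomorphic) auto
    then show "continuous_on \<bbbD> f" by (rule holomorphic_on_imp_continuous_on)
  qed
  note [measurable] = f_meas
  \<comment> \<open>The majorant \<open>norm (f z * w z)\<close> works for all \<open>j\<close>
    since the cut-off weights stay below \<open>w\<close> and \<open>cmod z ^ n\<close> below
    1.\<close>
  have "(\<lambda>j. \<integral> z. f z * (cnj z ^ n * of_real (h j z)) \<partial>disc_area) \<longlonglongrightarrow>
      (\<integral> z. f z * (cnj z ^ n * of_real (w z)) \<partial>disc_area)"
  proof (rule integral_dominated_convergence[where w = "\<lambda>z. norm (f z * of_real (w z))"])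
    show "AE z in disc_area. (\<lambda>j. f z * (cnj z ^ n * of_real (h j z))) \<longlonglongrightarrow> f z * (cnj z ^ n * of_real (w z))"
      using h_lim by (intro AE_I2 tendsto_intros) auto
    show "AE z in disc_area. norm (f z * (cnj z ^ n * of_real (h j z))) \<le> norm (f z * of_real (w z))" for j
    proof (intro AE_I2)
      fix z assume "z \<in> space disc_area"
      then have z: "z \<in> \<bbbD>" by simp
      have "cmod z ^ n * \<bar>h j z\<bar> \<le> 1 * \<bar>w z\<bar>"
        using power_disc_le_1[OF z] h_le[OF z, of j] by (intro mult_mono) auto
      then show "norm (f z * (cnj z ^ n * of_real (h j z))) \<le> norm (f z * of_real (w z))"
        by (simp add: norm_mult norm_power mult_left_mono)
    qed
  qed (use f in \<open>measurable, simp\<close>)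
  moreover have "(\<lambda>j. a n * of_real (\<integral> z. cmod z ^ (2 * n) * h j z \<partial>disc_area)) \<longlonglongrightarrow>
      a n * of_real (disc_moment w n)"
    unfolding disc_moment_def
  proof (intro tendsto_intros integral_dominated_convergence[where w = w])
    show "AE z in disc_area. (\<lambda>j. cmod z ^ (2 * n) * h j z) \<longlonglongrightarrow> cmod z ^ (2 * n) * w z"
      using h_lim by (intro AE_I2 tendsto_intros) auto
    show "AE z in disc_area. norm (cmod z ^ (2 * n) * h j z) \<le> w z" for j
    proof (intro AE_I2)
      fix z assume "z \<in> space disc_area"
      then have z: "z \<in> \<bbbD>" by simp
      have "cmod z ^ (2 * n) * \<bar>h j z\<bar> \<le> 1 * w z"
        using power_disc_le_1[OF z] h_le[OF z, of j] by (intro mult_mono) auto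
      then show "norm (cmod z ^ (2 * n) * h j z) \<le> w z"
        by (simp add: abs_mult)
    qed
    show "integrable disc_area w"
      by (rule weight_integrable)
  qed measurable
  ultimately show ?thesis
    unfolding eq by (rule LIMSEQ_unique)
qed

lemma holomorphic_taylor_sums:
  assumes "f holomorphic_on \<bbbD>" "z \<in> \<bbbD>"
  shows "(\<lambda>k. (deriv ^^ k) f 0 / fact k * z ^ k) sums f z"
  using holomorphic_power_series[OF assms] by simp

text \<open>Pairing \<open>f\<close> with the \<open>n\<close>-th kernel term produces its Taylor
  coefficient times the moment; the moment cancels, and the sum is the Taylor series of
  \<open>f\<close> at \<open>z\<close>.\<close>

lemma kernel_series_reproducing:
  assumes "z \<in> \<bbbD>" and f: "f \<in> bergman_space 2 w"
  shows "f z = (\<integral> \<zeta>. f \<zeta> * cnj (kernel_series w z \<zeta>) * of_real (w \<zeta>) \<partial>disc_area)"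
proof -
  let ?a = "\<lambda>k. (deriv ^^ k) f 0 / fact k"
  have hol: "f holomorphic_on \<bbbD>" using f by (simp add: bergman_space_def)
  have int: "integrable disc_area (\<lambda>z. f z * of_real (w z))"
    by (rule bergman_space_integrable[OF f])
  have "(\<lambda>n. \<integral> \<zeta>. cnj (cnj z ^ n / of_real (disc_moment w n) * \<zeta> ^ n) * (f \<zeta> * of_real (w \<zeta>)) \<partial>disc_area) sums
      (\<integral> \<zeta>. (\<Sum>n. cnj (cnj z ^ n / of_real (disc_moment w n) * \<zeta> ^ n)) * (f \<zeta> * of_real (w \<zeta>)) \<partial>disc_area)"
  proof (rule integral_series[OF int _ _ summable_kernel_coeffs[OF assms(1)]])
    show "cmod (cnj (cnj z ^ n / of_real (disc_moment w n) * \<zeta> ^ n)) \<le> cmod z ^ n / disc_moment w n"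
      if "\<zeta> \<in> space disc_area" for n \<zeta>
      using kernel_term_le that by (simp del: complex_cnj_mult complex_cnj_divide complex_cnj_power)
    show "0 \<le> cmod z ^ n / disc_moment w n" for n
      using disc_moment_pos[of n] by simp
  qed (intro borel_measurable_disc_areaI continuous_intros, auto simp: disc_moment_pos less_imp_neq[symmetric])
  also have "(\<integral> \<zeta>. (\<Sum>n. cnj (cnj z ^ n / of_real (disc_moment w n) * \<zeta> ^ n)) * (f \<zeta> * of_real (w \<zeta>)) \<partial>disc_area) =
      (\<integral> \<zeta>. f \<zeta> * cnj (kernel_series w z \<zeta>) * of_real (w \<zeta>) \<partial>disc_area)"
  proof (rule Bochner_Integration.integral_cong)
    fix \<zeta> assume "\<zeta> \<in> space disc_area"
    then have "\<zeta> \<in> \<bbbD>" by simp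
    then have "(\<lambda>n. cnj (cnj z ^ n / of_real (disc_moment w n) * \<zeta> ^ n)) sums cnj (kernel_series w z \<zeta>)"
      using kernel_series_sums[OF assms(1)] by (simp only: sums_cnj)
    then show "(\<Sum>n. cnj (cnj z ^ n / of_real (disc_moment w n) * \<zeta> ^ n)) * (f \<zeta> * of_real (w \<zeta>)) =
        f \<zeta> * cnj (kernel_series w z \<zeta>) * of_real (w \<zeta>)"
      using sums_unique by force
  qed simp
  also have "(\<lambda>n. \<integral> \<zeta>. cnj (cnj z ^ n / of_real (disc_moment w n) * \<zeta> ^ n) * (f \<zeta> * of_real (w \<zeta>)) \<partial>disc_area) =
      (\<lambda>n. ?a n * z ^ n)"
  proof
    fix n
    have "(\<integral> \<zeta>. cnj (cnj z ^ n / of_real (disc_moment w n) * \<zeta> ^ n) * (f \<zeta> * of_real (w \<zeta>)) \<partial>disc_area) =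
        (\<integral> \<zeta>. z ^ n / of_real (disc_moment w n) * (f \<zeta> * (cnj \<zeta> ^ n * of_real (w \<zeta>))) \<partial>disc_area)"
      by (simp add: mult_ac)
    also have "\<dots> = z ^ n / of_real (disc_moment w n) * (?a n * of_real (disc_moment w n))"
      by (subst integral_mult_right_zero, subst taylor_coeff_integral[where a = ?a])
         (use holomorphic_taylor_sums[OF hol] int in auto)
    also have "\<dots> = ?a n * z ^ n"
      using disc_moment_pos[of n] by simp
    finally show "(\<integral> \<zeta>. cnj (cnj z ^ n / of_real (disc_moment w n) * \<zeta> ^ n) * (f \<zeta> * of_real (w \<zeta>)) \<partial>disc_area) =
        ?a n * z ^ n" .
  qed
  finally show ?thesis
    using holomorphic_taylor_sums[OF hol assms(1)] sums_unique2 by blast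
qed

text \<open>The series witnesses that the choice is not vacuous. Conversely, testing the reproducing
  property of the chosen \<open>K\<close> on monomials and conjugating determines every Taylor
  coefficient of \<open>K\<close>.\<close>

lemma bergman_kernel_eq_series:
  assumes z: "z \<in> \<bbbD>" and \<zeta>: "\<zeta> \<in> \<bbbD>"
  shows "bergman_kernel w z \<zeta> = kernel_series w z \<zeta>"
proof -
  define K where "K = bergman_kernel w z"
  let ?a = "\<lambda>k. (deriv ^^ k) K 0 / fact k"
  have "kernel_series w z \<in> bergman_space 2 w"
    using kernel_series_holomorphic[OF z] kernel_series_bounded[OF z]
    by (rule bounded_holomorphic_in_bergman_space)
  then have "\<exists>K. K \<in> bergman_space 2 w \<and>
      (\<forall>f\<in>bergman_space 2 w. f z = (\<integral>\<zeta>. f \<zeta> * cnj (K \<zeta>) * of_real (w \<zeta>) \<partial>disc_area))"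
    using kernel_series_reproducing[OF z] by blast
  from someI_ex[OF this] have K: "K \<in> bergman_space 2 w"
    and repr: "\<And>f. f \<in> bergman_space 2 w \<Longrightarrow> f z = (\<integral>\<zeta>. f \<zeta> * cnj (K \<zeta>) * of_real (w \<zeta>) \<partial>disc_area)"
    unfolding K_def bergman_kernel_def by blast+
  have hol: "K holomorphic_on \<bbbD>" using K by (simp add: bergman_space_def)
  have coeff: "?a n = cnj z ^ n / of_real (disc_moment w n)" for n
  proof -
    have "(\<lambda>z. z ^ n) \<in> bergman_space 2 w"
    proof (rule bounded_holomorphic_in_bergman_space)
      show "cmod (z ^ n) \<le> 1" if "z \<in> \<bbbD>" for z
        using power_disc_le_1[OF that] by (simp add: norm_power)
    qed (intro holomorphic_intros)
    then have "cnj (z ^ n) = cnj (\<integral>\<zeta>. \<zeta> ^ n * cnj (K \<zeta>) * of_real (w \<zeta>) \<partial>disc_area)"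
      using repr by auto
    also have "\<dots> = (\<integral>\<zeta>. cnj (\<zeta> ^ n * cnj (K \<zeta>) * of_real (w \<zeta>)) \<partial>disc_area)"
      by (rule Bochner_Integration.integral_cnj [symmetric])
    also have "\<dots> = (\<integral>\<zeta>. K \<zeta> * (cnj \<zeta> ^ n * of_real (w \<zeta>)) \<partial>disc_area)"
      by (simp add: mult_ac)
    also have "\<dots> = ?a n * of_real (disc_moment w n)"
      by (rule taylor_coeff_integral[OF holomorphic_taylor_sums[OF hol] bergman_space_integrable[OF K]])
    finally show ?thesis
      using disc_moment_pos[of n] by (simp add: field_simps)
  qed
  have "K \<zeta> = (\<Sum>k. ?a k * \<zeta> ^ k)"
    using holomorphic_taylor_sums[OF hol \<zeta>] sums_unique by blast
  also have "\<dots> = kernel_series w z \<zeta>"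
    unfolding coeff kernel_series_def ..
  finally show ?thesis by (simp add: K_def)
qed

text \<open>Only the kernel term of index \<open>n\<close> survives against
  \<open>\<zeta> ^ n\<close> times a radial function. The kernel terms are bounded by a summable
  sequence at fixed \<open>z\<close>, so integrability against the weight justifies the exchange for
  unbounded \<open>g\<close>.\<close>

lemma bergman_projection_monomial_radial:
  assumes [measurable]: "g \<in> borel_measurable disc_area"
    and g_radial: "\<And>z. z \<in> \<bbbD> \<Longrightarrow> g z = g (of_real (cmod z))"
    and g_nonneg: "\<And>z. z \<in> \<bbbD> \<Longrightarrow> 0 \<le> g z"
    and int: "integrable disc_area (\<lambda>\<zeta>. \<zeta> ^ n * of_real (g \<zeta>) * of_real (w \<zeta>))"
    and z: "z \<in> \<bbbD>"
  shows "bergman_projection w (\<lambda>\<zeta>. \<zeta> ^ n * of_real (g \<zeta>)) z =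
    z ^ n * of_real ((\<integral> \<zeta>. cmod \<zeta> ^ (2 * n) * (g \<zeta> * w \<zeta>) \<partial>disc_area) / disc_moment w n)"
proof -
  let ?I = "\<integral> \<zeta>. cmod \<zeta> ^ (2 * n) * (g \<zeta> * w \<zeta>) \<partial>disc_area"
  have "(\<lambda>k. \<integral> \<zeta>. cnj (cnj z ^ k / of_real (disc_moment w k) * \<zeta> ^ k) * (\<zeta> ^ n * of_real (g \<zeta>) * of_real (w \<zeta>)) \<partial>disc_area) sums
      (\<integral> \<zeta>. (\<Sum>k. cnj (cnj z ^ k / of_real (disc_moment w k) * \<zeta> ^ k)) * (\<zeta> ^ n * of_real (g \<zeta>) * of_real (w \<zeta>)) \<partial>disc_area)"
  proof (rule integral_series[OF int _ _ summable_kernel_coeffs[OF z]])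
    show "cmod (cnj (cnj z ^ n / of_real (disc_moment w n) * \<zeta> ^ n)) \<le> cmod z ^ n / disc_moment w n"
      if "\<zeta> \<in> space disc_area" for n \<zeta>
      using kernel_term_le that by (simp del: complex_cnj_mult complex_cnj_divide complex_cnj_power)
    show "0 \<le> cmod z ^ n / disc_moment w n" for n
      using disc_moment_pos[of n] by simp
  qed (intro borel_measurable_disc_areaI continuous_intros, auto simp: disc_moment_pos less_imp_neq[symmetric])
  also have "(\<integral> \<zeta>. (\<Sum>k. cnj (cnj z ^ k / of_real (disc_moment w k) * \<zeta> ^ k)) * (\<zeta> ^ n * of_real (g \<zeta>) * of_real (w \<zeta>)) \<partial>disc_area) =
      bergman_projection w (\<lambda>\<zeta>. \<zeta> ^ n * of_real (g \<zeta>)) z"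
    unfolding bergman_projection_def
  proof (rule Bochner_Integration.integral_cong)
    fix \<zeta> assume "\<zeta> \<in> space disc_area"
    then have \<zeta>: "\<zeta> \<in> \<bbbD>" by simp
    then have "(\<lambda>n. cnj (cnj z ^ n / of_real (disc_moment w n) * \<zeta> ^ n)) sums cnj (kernel_series w z \<zeta>)"
      using kernel_series_sums[OF z] by (simp only: sums_cnj)
    then have "(\<Sum>k. cnj (cnj z ^ k / of_real (disc_moment w k) * \<zeta> ^ k)) = cnj (kernel_series w z \<zeta>)"
      by (rule sums_unique [symmetric])
    then show "(\<Sum>k. cnj (cnj z ^ k / of_real (disc_moment w k) * \<zeta> ^ k)) * (\<zeta> ^ n * of_real (g \<zeta>) * of_real (w \<zeta>)) =
        \<zeta> ^ n * of_real (g \<zeta>) * cnj (bergman_kernel w z \<zeta>) * of_real (w \<zeta>)"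
      by (simp only: bergman_kernel_eq_series[OF z \<zeta>] mult_ac)
  qed simp
  also have "(\<lambda>k. \<integral> \<zeta>. cnj (cnj z ^ k / of_real (disc_moment w k) * \<zeta> ^ k) * (\<zeta> ^ n * of_real (g \<zeta>) * of_real (w \<zeta>)) \<partial>disc_area) =
      (\<lambda>k. if k = n then z ^ n * of_real (?I / disc_moment w n) else 0)"
  proof
    fix k
    have "(\<integral> \<zeta>. cnj (cnj z ^ k / of_real (disc_moment w k) * \<zeta> ^ k) * (\<zeta> ^ n * of_real (g \<zeta>) * of_real (w \<zeta>)) \<partial>disc_area) =
        (\<integral> \<zeta>. z ^ k / of_real (disc_moment w k) * (\<zeta> ^ n * cnj \<zeta> ^ k * of_real (g \<zeta> * w \<zeta>)) \<partial>disc_area)"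
      by (simp add: mult_ac)
    also have "\<dots> = z ^ k / of_real (disc_moment w k) * (\<integral> \<zeta>. \<zeta> ^ n * cnj \<zeta> ^ k * of_real (g \<zeta> * w \<zeta>) \<partial>disc_area)"
      by (rule integral_mult_right_zero)
    also have "(\<integral> \<zeta>. \<zeta> ^ n * cnj \<zeta> ^ k * of_real (g \<zeta> * w \<zeta>) \<partial>disc_area) = (if k = n then of_real ?I else 0)"
    proof (cases "k = n")
      case True
      have "z ^ n * cnj z ^ n * of_real (g z * w z) = of_real (cmod z ^ (2 * n) * (g z * w z))" for z
        by (simp add: power_mult_distrib [symmetric] complex_norm_square [symmetric] power_mult)
      then show ?thesis using True by (simp only: integral_complex_of_real simp_thms if_True)
    next
      case False
      have "(\<integral> \<zeta>. \<zeta> ^ n * cnj \<zeta> ^ k * of_real (g \<zeta> * w \<zeta>) \<partial>disc_area) = 0"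
      proof (rule integral_monomials_orthogonal)
        show "g z * w z = g (of_real (cmod z)) * w (of_real (cmod z))" if "z \<in> \<bbbD>" for z
          using g_radial[OF that] weight_radial[OF that] by metis
        show "0 \<le> g z * w z" if "z \<in> \<bbbD>" for z
          using g_nonneg[OF that] weight_nonneg[OF that] by simp
      qed (use False in \<open>measurable, simp\<close>)
      with False show ?thesis by simp
    qed
    also have "z ^ k / of_real (disc_moment w k) * (if k = n then of_real ?I else 0) =
        (if k = n then z ^ n * of_real (?I / disc_moment w n) else 0)"
      by simp
    finally show "(\<integral> \<zeta>. cnj (cnj z ^ k / of_real (disc_moment w k) * \<zeta> ^ k) * (\<zeta> ^ n * of_real (g \<zeta>) * of_real (w \<zeta>)) \<partial>disc_area) =
        (if k = n then z ^ n * of_real (?I / disc_moment w n) else 0)" .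
  qed
  finally have "(\<lambda>k. if k = n then z ^ n * of_real (?I / disc_moment w n) else 0) sums
      bergman_projection w (\<lambda>\<zeta>. \<zeta> ^ n * of_real (g \<zeta>)) z" .
  with sums_single[of n "\<lambda>k. z ^ n * of_real (?I / disc_moment w n)"]
  show ?thesis
    using sums_unique2 by blast
qed

end

text \<open>The origin must be excepted: for \<open>n = 0\<close> the left side is 1 there, whereas
  \<open>0 powr 0\<close> is 0.\<close>

lemma cmod_power_powr_AE: "AE z in disc_area. (cmod z ^ n) powr y = cmod z powr (real n * y)"
proof -
  have "AE z in disc_area. z \<noteq> 0"
    unfolding AE_disc_area using AE_lborel_singleton[of "0::complex"] by eventually_elim auto
  then show ?thesis
    by eventually_elim (simp add: powr_realpow [symmetric] powr_powr)
qed

section \<open>Test functions for the projection\<close>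

text \<open>Twice the moment of order \<open>y + 1\<close>, as a real number; real \<open>y\<close>
  is required for the exponent \<open>n * p\<close>.\<close>

definition radial_moment :: "(complex \<Rightarrow> real) \<Rightarrow> real \<Rightarrow> real" where
  "radial_moment w y = (\<integral> z. cmod z powr y * w z \<partial>disc_area)"

context disc_weight
begin

lemma radial_moment_integrable:
  assumes "0 \<le> y"
  shows "integrable disc_area (\<lambda>z. cmod z powr y * w z)"
proof -
  have "integrable disc_area (\<lambda>z. cmod z powr y * of_real (w z))"
  proof (rule integrable_weight_mult)
    show "norm (cmod z powr y) \<le> 1" if "z \<in> \<bbbD>" for z
      using that assms by (simp add: powr_le1)
  qed measurable
  then show ?thesis by simp
qed

lemma nn_integral_radial_moment:
  assumes "0 \<le> y"
  shows "(\<integral>\<^sup>+ z. ennreal (cmod z powr y * w z) \<partial>disc_area) = ennreal (radial_moment w y)"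
  unfolding radial_moment_def using weight_nonneg
  by (intro nn_integral_eq_integral radial_moment_integrable[OF assms] AE_I2) simp

lemma radial_moment_nonneg: "0 \<le> radial_moment w y"
  unfolding radial_moment_def using weight_nonneg by (intro integral_nonneg_AE AE_I2) simp

lemma radial_moment_pos:
  assumes "0 \<le> y"
  shows "0 < radial_moment w y"
proof -
  have "radial_moment w y \<noteq> 0"
  proof
    assume "radial_moment w y = 0"
    moreover have "AE z in disc_area. 0 \<le> cmod z powr y * w z"
      using weight_nonneg by (intro AE_I2) simp
    ultimately have "AE z in disc_area. cmod z powr y * w z = 0"
      unfolding radial_moment_def
      using integral_nonneg_eq_0_iff_AE[OF radial_moment_integrable[OF assms]] by blast
    then have "AE z in disc_area. indicator {z. 0 < cmod z} z * w z = 0"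
      by eventually_elim (auto simp: indicator_def)
    then have "(\<integral> z. indicator {z. 0 < cmod z} z * w z \<partial>disc_area) = 0"
      by (rule integral_eq_zero_AE)
    with tail_mass_pos[of 0] show False by simp
  qed
  with radial_moment_nonneg[of y] show ?thesis by simp
qed

lemma moment_eq_radial_moment:
  assumes "1 \<le> x"
  shows "moment (\<lambda>z. ennreal (w z)) x = ennreal (radial_moment w (x - 1) / 2)"
proof -
  have "2 * moment (\<lambda>z. ennreal (w z)) x = (\<integral>\<^sup>+ z. ennreal (cmod z powr (x - 1)) * ennreal (w z) \<partial>disc_area)"
  proof (rule moment_eq_disc_integral [symmetric])
    show "ennreal (w z) = ennreal (w (of_real (cmod z)))" if "z \<in> \<bbbD>" for z
      using weight_radial[OF that] by (rule arg_cong)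
  qed measurable
  also have "\<dots> = (\<integral>\<^sup>+ z. ennreal (cmod z powr (x - 1) * w z) \<partial>disc_area)"
    using weight_nonneg by (intro nn_integral_cong) (simp add: ennreal_mult)
  also have "\<dots> = ennreal (radial_moment w (x - 1))"
    using assms by (intro nn_integral_radial_moment) simp
  also have "\<dots> = 2 * ennreal (radial_moment w (x - 1) / 2)"
    using radial_moment_nonneg[of "x - 1"]
    by (subst ennreal_numeral [symmetric], subst ennreal_mult [symmetric]) auto
  finally show ?thesis
    by (simp add: ennreal_mult_cancel_left)
qed

lemma disc_moment_eq_radial_moment: "disc_moment w n = radial_moment w (2 * real n)"
  unfolding disc_moment_def radial_moment_def
proof (rule integral_cong_AE)
  show "AE z in disc_area. cmod z ^ (2 * n) * w z = cmod z powr (2 * real n) * w z"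
    using cmod_power_powr_AE[of n 2] by eventually_elim (simp add: power_mult power_even_eq mult.commute)
qed measurable

text \<open>Agreement with the monomial is asked on the disc only, because projections are computed
  only there.\<close>

lemma Lp_norm_monomial:
  assumes p: "1 < p" and c: "0 \<le> c" and f: "\<And>z. z \<in> \<bbbD> \<Longrightarrow> f z = z ^ n * of_real c"
  shows "Lp_norm p w f = ennreal (c * radial_moment w (real n * p) powr (1 / p))"
proof -
  have "(\<integral>\<^sup>+ z. ennreal (cmod (f z) powr p * w z) \<partial>disc_area) =
      (\<integral>\<^sup>+ z. ennreal (c powr p) * ennreal (cmod z powr (real n * p) * w z) \<partial>disc_area)"
  proof (rule nn_integral_cong_AE)
    show "AE z in disc_area. ennreal (cmod (f z) powr p * w z) =
        ennreal (c powr p) * ennreal (cmod z powr (real n * p) * w z)"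
      using cmod_power_powr_AE[of n p] AE_space
    proof eventually_elim
      case (elim z)
      then have "cmod (f z) powr p = cmod z powr (real n * p) * c powr p"
        using c by (simp add: f norm_mult norm_power powr_mult)
      then show ?case
        using weight_nonneg[of z] elim(2) by (simp add: ennreal_mult [symmetric] mult_ac)
    qed
  qed
  also have "\<dots> = ennreal (c powr p) * ennreal (radial_moment w (real n * p))"
    using p by (subst nn_integral_cmult) (auto simp: nn_integral_radial_moment)
  also have "\<dots> = ennreal (c powr p * radial_moment w (real n * p))"
    using radial_moment_nonneg by (simp add: ennreal_mult)
  finally show ?thesis
    unfolding Lp_norm_def using radial_moment_nonneg[of "real n * p"] p c
    by (simp add: enn_powr_def powr_mult powr_powr)
qed

end

text \<open>\<open>C\<close> is any admissible real constant instead of the operator norm: a bound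
  by every such \<open>C\<close> is a bound by the infimum.\<close>

locale bounded_projection = \<omega>: disc_weight \<omega> + \<nu>: disc_weight \<nu> for \<omega> \<nu> :: "complex \<Rightarrow> real" +
  fixes p C :: real
  assumes p: "1 < p"
    and bounded: "bergman_projection_bounded p \<omega> \<nu>"
    and C_nonneg: "0 \<le> C"
    and C: "f \<in> Lp_space p \<nu> \<Longrightarrow> Lp_norm p \<nu> (bergman_projection \<omega> f) \<le> ennreal C * Lp_norm p \<nu> f"
begin

text \<open>The projection of the test function is a multiple of \<open>z ^ n\<close>, so its norm
  is explicit and boundedness becomes an inequality between numbers.\<close>

lemma test_function_inequality:
  assumes g [measurable]: "g \<in> borel_measurable disc_area"
    and g_radial: "\<And>z. z \<in> \<bbbD> \<Longrightarrow> g z = g (of_real (cmod z))"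
    and g_nonneg: "\<And>z. z \<in> \<bbbD> \<Longrightarrow> 0 \<le> g z"
    and N: "0 \<le> N" "Lp_norm p \<nu> (\<lambda>\<zeta>. \<zeta> ^ n * of_real (g \<zeta>)) = ennreal N"
  shows "integrable disc_area (\<lambda>\<zeta>. cmod \<zeta> ^ n * (g \<zeta> * \<omega> \<zeta>))" (is ?int)
    and "(\<integral> \<zeta>. cmod \<zeta> ^ (2 * n) * (g \<zeta> * \<omega> \<zeta>) \<partial>disc_area) / disc_moment \<omega> n *
      radial_moment \<nu> (real n * p) powr (1 / p) \<le> C * N" (is "?I / _ * _ \<le> _")
proof -
  let ?f = "\<lambda>\<zeta>. \<zeta> ^ n * complex_of_real (g \<zeta>)"
  have f: "?f \<in> Lp_space p \<nu>"
    using N by (simp add: Lp_space_def)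
  \<comment> \<open>At the origin all kernel terms but the constant one vanish. Multiplying by
    \<open>disc_moment \<omega> 0\<close> cancels that constant and leaves integrability of the test
    function against \<open>\<omega>\<close>.\<close>
  have kernel_0: "bergman_kernel \<omega> 0 \<zeta> = 1 / of_real (disc_moment \<omega> 0)" if "\<zeta> \<in> \<bbbD>" for \<zeta>
  proof -
    have "bergman_kernel \<omega> 0 \<zeta> = (\<Sum>n. cnj 0 ^ n / of_real (disc_moment \<omega> n) * \<zeta> ^ n)"
      using \<omega>.bergman_kernel_eq_series[of 0 \<zeta>] that by (simp add: kernel_series_def)
    also have "\<dots> = (\<Sum>n\<in>{0}. cnj 0 ^ n / of_real (disc_moment \<omega> n) * \<zeta> ^ n)"
      by (rule suminf_finite) auto
    finally show ?thesis by simp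
  qed
  have "integrable disc_area (\<lambda>\<zeta>. ?f \<zeta> * cnj (bergman_kernel \<omega> 0 \<zeta>) * of_real (\<omega> \<zeta>))"
    using bounded f unfolding bergman_projection_bounded_def by simp
  then have "integrable disc_area (\<lambda>\<zeta>. of_real (disc_moment \<omega> 0) *
      (?f \<zeta> * cnj (bergman_kernel \<omega> 0 \<zeta>) * of_real (\<omega> \<zeta>)))"
    by (rule integrable_mult_right)
  also have "?this \<longleftrightarrow> integrable disc_area (\<lambda>\<zeta>. ?f \<zeta> * of_real (\<omega> \<zeta>))"
    using \<omega>.disc_moment_pos[of 0]
    by (intro Bochner_Integration.integrable_cong) (auto simp: kernel_0)
  finally have int: "integrable disc_area (\<lambda>\<zeta>. ?f \<zeta> * of_real (\<omega> \<zeta>))" .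
  have "integrable disc_area (\<lambda>\<zeta>. norm (?f \<zeta> * of_real (\<omega> \<zeta>)))"
    using int by (rule integrable_norm)
  also have "?this \<longleftrightarrow> ?int"
    using g_nonneg \<omega>.weight_nonneg
    by (intro Bochner_Integration.integrable_cong) (auto simp: norm_mult norm_power)
  finally show ?int .
  have I: "0 \<le> ?I / disc_moment \<omega> n"
    using g_nonneg \<omega>.weight_nonneg \<omega>.disc_moment_pos[of n]
    by (intro divide_nonneg_pos integral_nonneg_AE AE_I2) auto
  have "Lp_norm p \<nu> (bergman_projection \<omega> ?f) =
      ennreal (?I / disc_moment \<omega> n * radial_moment \<nu> (real n * p) powr (1 / p))"
    by (rule \<nu>.Lp_norm_monomial[OF p I])
       (rule \<omega>.bergman_projection_monomial_radial[OF g g_radial g_nonneg int])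
  with C[OF f] N have "ennreal (?I / disc_moment \<omega> n * radial_moment \<nu> (real n * p) powr (1 / p)) \<le> ennreal (C * N)"
    using C_nonneg by (simp add: ennreal_mult)
  then show "?I / disc_moment \<omega> n * radial_moment \<nu> (real n * p) powr (1 / p) \<le> C * N"
    using C_nonneg N(1) by (simp add: ennreal_le_iff)
qed

text \<open>Testing on the indicator of \<open>{\<nu> = 0}\<close>, which has norm zero.\<close>

lemma AE_zero_weight: "AE z in disc_area. \<nu> z = 0 \<longrightarrow> \<omega> z = 0"
proof -
  define g where "g z = (if \<nu> z = 0 then 1 else 0 :: real)" for z
  have [measurable]: "g \<in> borel_measurable disc_area"
    unfolding g_def by measurable
  have g_radial: "g z = g (of_real (cmod z))" if "z \<in> \<bbbD>" for z
    unfolding g_def using \<nu>.weight_radial[OF that] by metis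
  have "(\<integral>\<^sup>+ z. ennreal (cmod (z ^ 0 * complex_of_real (g z)) powr p * \<nu> z) \<partial>disc_area) = (\<integral>\<^sup>+ z. 0 \<partial>(disc_area))"
    by (rule nn_integral_cong) (simp add: g_def)
  then have norm_0: "Lp_norm p \<nu> (\<lambda>z. z ^ 0 * complex_of_real (g z)) = ennreal 0"
    by (simp add: Lp_norm_def enn_powr_def)
  have g_nonneg: "0 \<le> g z" for z by (simp add: g_def)
  note test = test_function_inequality[where n = 0, OF _ g_radial g_nonneg order_refl norm_0]
  have int: "integrable disc_area (\<lambda>\<zeta>. g \<zeta> * \<omega> \<zeta>)"
    using test(1) by simp
  have "(\<integral> \<zeta>. g \<zeta> * \<omega> \<zeta> \<partial>disc_area) / disc_moment \<omega> 0 * radial_moment \<nu> 0 powr (1 / p) \<le> 0"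
    using test(2) by simp
  moreover have "0 < radial_moment \<nu> 0 powr (1 / p)"
    using \<nu>.radial_moment_pos[of 0] by simp
  ultimately have "(\<integral> \<zeta>. g \<zeta> * \<omega> \<zeta> \<partial>disc_area) \<le> 0"
    using \<omega>.disc_moment_pos[of 0] by (simp add: mult_le_0_iff divide_le_0_iff not_less)
  moreover have nn: "AE \<zeta> in disc_area. 0 \<le> g \<zeta> * \<omega> \<zeta>"
    using \<omega>.weight_nonneg g_nonneg by (intro AE_I2) simp
  ultimately have "(\<integral> \<zeta>. g \<zeta> * \<omega> \<zeta> \<partial>disc_area) = 0"
    using integral_nonneg_AE[OF nn] by simp
  then have "AE \<zeta> in disc_area. g \<zeta> * \<omega> \<zeta> = 0"
    using integral_nonneg_eq_0_iff_AE[OF int nn] by simp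
  then show ?thesis
    by eventually_elim (auto simp: g_def)
qed

end

text \<open>Comparison of exponents: \<open>n * p + p * n * (2 - p) / (p - 1)\<close> and
  \<open>2 * n + n * (2 - p) / (p - 1)\<close> both equal \<open>n * p'\<close>, and
  \<open>1 / (p - 1) + 1 = p'\<close>. This is the equality case of Hoelder. Logarithms reduce it to
  field arithmetic, with \<open>a = 0\<close> apart.\<close>

lemma extremal_function_identities:
  fixes p r a b :: real
  assumes p: "1 < p" and r: "0 < r" and a: "0 \<le> a" and b: "0 < b"
  shows "(r ^ n * (r powr (real n * (2 - p) / (p - 1)) * (a / b) powr (1 / (p - 1)))) powr p * b =
      r powr (real n * conj_exponent p) * (a / b powr (1 / p)) powr conj_exponent p" (is "?L1 = ?R")
    and "r ^ (2 * n) * (r powr (real n * (2 - p) / (p - 1)) * (a / b) powr (1 / (p - 1)) * a) =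
      r powr (real n * conj_exponent p) * (a / b powr (1 / p)) powr conj_exponent p" (is "?L2 = ?R")
proof -
  define d where "d = p - 1"
  have d: "0 < d" "p = d + 1"
    using p by (simp_all add: d_def)
  have "?L1 = ?R \<and> ?L2 = ?R"
  proof (cases "a = 0")
    case True
    then show ?thesis by simp
  next
    case False
    with a have a: "0 < a" by simp
    have R: "0 < ?R" using r a b by simp
    have "ln ?R = real n * (p / (p - 1)) * ln r + p / (p - 1) * (ln a - ln b / p)"
      using r a b by (simp add: ln_mult ln_powr ln_div conj_exponent_def)
    also have "\<dots> = real n * (p / (p - 1)) * ln r + p / (p - 1) * ln a - ln b / (p - 1)"
      using p by (simp add: right_diff_distrib)
    finally have lnR: "ln ?R = real n * (p / (p - 1)) * ln r + p / (p - 1) * ln a - ln b / (p - 1)" .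
    have "ln ?L1 = p * (real n * ln r + (real n * (2 - p) / (p - 1) * ln r + 1 / (p - 1) * (ln a - ln b))) + ln b"
      using r a b by (simp add: ln_mult ln_powr ln_div ln_realpow)
    also have "\<dots> = ln ?R"
      unfolding lnR using d(1) by (simp add: d(2) field_simps)
    finally have 1: "?L1 = ?R"
      using R r a b by (subst (asm) ln_inj_iff) simp_all
    have "ln ?L2 = real (2 * n) * ln r + (real n * (2 - p) / (p - 1) * ln r + 1 / (p - 1) * (ln a - ln b) + ln a)"
      using r a b by (simp add: ln_mult ln_powr ln_div ln_realpow)
    also have "\<dots> = ln ?R"
      unfolding lnR using d(1) by (simp add: d(2) field_simps)
    finally have 2: "?L2 = ?R"
      using R r a b by (subst (asm) ln_inj_iff) simp_all
    from 1 2 show ?thesis ..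
  qed
  then show "?L1 = ?R" "?L2 = ?R" by auto
qed

lemma conj_exponent_props:
  assumes "1 < p"
  shows "1 < conj_exponent p" "1 / p + 1 / conj_exponent p = 1"
  using assms by (simp_all add: conj_exponent_def field_simps)

section \<open>Integrals of the dual weight and the bound by an admissible constant\<close>

context bounded_projection
begin

text \<open>On the truncation set the integral \<open>S\<close> is finite, so
  \<open>S <= B * S powr (1 / p)\<close> may be divided by the power of \<open>S\<close>. The
  resulting bound is independent of \<open>m\<close>, as the later limit requires.\<close>

lemma truncated_dual_integral_le:
  fixes n m :: nat
  defines "q \<equiv> conj_exponent p"
  defines "E \<equiv> {z. 1 / Suc m < cmod z \<and> 1 / Suc m < \<nu> z \<and> \<omega> z < Suc m}"
  defines "s \<equiv> \<lambda>z. indicator E z * (cmod z powr (real n * q) * (\<omega> z / \<nu> z powr (1 / p)) powr q)"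
  shows "(\<integral>\<^sup>+ z. ennreal (s z) \<partial>disc_area) \<le>
    ennreal ((C * disc_moment \<omega> n / radial_moment \<nu> (real n * p) powr (1 / p)) powr q)"
proof -
  \<comment> \<open>Written in terms of the modulus and the two weight values, so that radiality of
    the test function is inherited from the weights.\<close>
  define G where "G r a b = (if 1 / Suc m < r \<and> 1 / Suc m < b \<and> a < Suc m
    then r powr (real n * (2 - p) / (p - 1)) * (a / b) powr (1 / (p - 1)) else 0)" for r a b :: real
  define g where "g z = G (cmod z) (\<omega> z) (\<nu> z)" for z
  have q: "1 < q" and pq: "1 / p + 1 / q = 1"
    using conj_exponent_props[OF p] by (simp_all add: q_def)
  have g_meas [measurable]: "g \<in> borel_measurable disc_area"
    unfolding g_def G_def by measurable
  have E_meas: "(indicator E :: complex \<Rightarrow> real) \<in> borel_measurable disc_area"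
  proof -
    have "(\<lambda>z. if 1 / Suc m < cmod z \<and> 1 / Suc m < \<nu> z \<and> \<omega> z < Suc m then 1 else 0 :: real) \<in> borel_measurable disc_area"
      by measurable
    then show ?thesis by (simp add: indicator_def E_def cong: if_cong)
  qed
  then have s_meas [measurable]: "s \<in> borel_measurable disc_area"
    unfolding s_def by measurable
  have g_radial: "g z = g (of_real (cmod z))" if "z \<in> \<bbbD>" for z
  proof -
    have "g (of_real (cmod z)) = G (cmod z) (\<omega> (of_real (cmod z))) (\<nu> (of_real (cmod z)))"
      by (simp add: g_def)
    then show ?thesis
      unfolding g_def using \<omega>.weight_radial[OF that] \<nu>.weight_radial[OF that] by metis
  qed
  have g_nonneg: "0 \<le> g z" if "z \<in> \<bbbD>" for z
    by (simp add: g_def G_def)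
  have s_nonneg: "0 \<le> s z" for z
    by (simp add: s_def)
  \<comment> \<open>The cut-off in the modulus keeps the radius positive, as the power identities
    require.\<close>
  have E_pos: "0 < cmod z" "0 < \<nu> z" if "z \<in> E" for z
    using that order.strict_trans[of 0 "1 / real (Suc m)"] by (auto simp: E_def simp del: of_nat_Suc)
  have s1: "cmod (z ^ n * of_real (g z)) powr p * \<nu> z = s z" if "z \<in> \<bbbD>" for z
  proof (cases "z \<in> E")
    case True
    then have "g z = cmod z powr (real n * (2 - p) / (p - 1)) * (\<omega> z / \<nu> z) powr (1 / (p - 1))"
      by (auto simp: g_def G_def E_def)
    then show ?thesis
      using True extremal_function_identities(1)[OF p E_pos(1)[OF True] \<omega>.weight_nonneg[OF that] E_pos(2)[OF True], of n]
      by (simp add: norm_mult norm_power s_def q_def abs_mult)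
  next
    case False
    then have "g z = 0" by (auto simp: g_def G_def E_def)
    with False show ?thesis by (simp add: s_def)
  qed
  have s2: "cmod z ^ (2 * n) * (g z * \<omega> z) = s z" if "z \<in> \<bbbD>" for z
  proof (cases "z \<in> E")
    case True
    then have "g z = cmod z powr (real n * (2 - p) / (p - 1)) * (\<omega> z / \<nu> z) powr (1 / (p - 1))"
      by (auto simp: g_def G_def E_def)
    then show ?thesis
      using True extremal_function_identities(2)[OF p E_pos(1)[OF True] \<omega>.weight_nonneg[OF that] E_pos(2)[OF True], of n]
      by (simp add: s_def q_def)
  next
    case False
    then have "g z = 0" by (auto simp: g_def G_def E_def)
    with False show ?thesis by (simp add: s_def)
  qed
  \<comment> \<open>The lower cut-off on \<open>\<nu>\<close> and the upper one on
    \<open>\<omega>\<close> bound the quotient; the power of the modulus has a nonnegative exponent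
    and is at most 1.\<close>
  have s_le: "s z \<le> (Suc m / (1 / Suc m) powr (1 / p)) powr q" if z: "z \<in> \<bbbD>" for z
  proof (cases "z \<in> E")
    case True
    have "\<omega> z / \<nu> z powr (1 / p) \<le> Suc m / (1 / Suc m) powr (1 / p)"
      using True p by (intro frac_le powr_mono2) (auto simp: E_def)
    then have "(\<omega> z / \<nu> z powr (1 / p)) powr q \<le> (Suc m / (1 / Suc m) powr (1 / p)) powr q"
      using \<omega>.weight_nonneg[OF z] q by (intro powr_mono2) auto
    moreover have "cmod z powr (real n * q) \<le> 1"
      using z q by (simp add: powr_le1)
    ultimately have "cmod z powr (real n * q) * (\<omega> z / \<nu> z powr (1 / p)) powr q \<le> 1 * (Suc m / (1 / Suc m) powr (1 / p)) powr q"
      by (intro mult_mono) auto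
    then show ?thesis using True by (simp add: s_def)
  qed (simp add: s_def)
  have s_int: "integrable disc_area s"
    by (rule disc_area.integrable_const_bound[where B = "(Suc m / (1 / Suc m) powr (1 / p)) powr q"])
       (use s_le s_nonneg in \<open>auto intro!: AE_I2\<close>)
  define S where "S = (\<integral> z. s z \<partial>disc_area)"
  have S_nonneg: "0 \<le> S"
    unfolding S_def using s_nonneg by (simp add: integral_nonneg_AE)
  have S_eq: "(\<integral>\<^sup>+ z. ennreal (s z) \<partial>disc_area) = ennreal S"
    unfolding S_def using s_int s_nonneg by (intro nn_integral_eq_integral) auto
  have "(\<integral>\<^sup>+ z. ennreal (cmod (z ^ n * of_real (g z)) powr p * \<nu> z) \<partial>disc_area) = ennreal S"
    unfolding S_eq [symmetric] by (rule nn_integral_cong) (simp add: s1)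
  then have norm_f: "Lp_norm p \<nu> (\<lambda>z. z ^ n * of_real (g z)) = ennreal (S powr (1 / p))"
    using S_nonneg by (simp add: Lp_norm_def enn_powr_def)
  have "(\<integral> z. cmod z ^ (2 * n) * (g z * \<omega> z) \<partial>disc_area) = S"
    unfolding S_def by (rule Bochner_Integration.integral_cong) (auto simp: s2)
  with test_function_inequality(2)[OF g_meas g_radial g_nonneg _ norm_f]
  have ineq: "S / disc_moment \<omega> n * radial_moment \<nu> (real n * p) powr (1 / p) \<le> C * S powr (1 / p)"
    by simp
  define \<mu> where "\<mu> = radial_moment \<nu> (real n * p) powr (1 / p)"
  define B where "B = C * disc_moment \<omega> n / \<mu>"
  have \<mu>: "0 < \<mu>"
    using \<nu>.radial_moment_pos[of "real n * p"] p by (simp add: \<mu>_def)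
  have B: "0 \<le> B"
    using C_nonneg \<omega>.disc_moment_pos[of n] \<mu> by (simp add: B_def)
  \<comment> \<open>For \<open>S > 0\<close>, division leaves \<open>S powr (1 - 1 / p)\<close>,
    which is \<open>S powr (1 / q)\<close>; raising to the power \<open>q\<close> finishes.\<close>
  have "S \<le> B powr q"
  proof (cases "S = 0")
    case False
    with S_nonneg have S: "0 < S" by simp
    have "S \<le> B * S powr (1 / p)"
      using ineq [folded \<mu>_def] \<mu> \<omega>.disc_moment_pos[of n] by (simp add: B_def field_simps)
    moreover have "S = S powr (1 / q) * S powr (1 / p)"
      using S pq by (simp add: powr_add [symmetric] add.commute)
    ultimately have "S powr (1 / q) * S powr (1 / p) \<le> B * S powr (1 / p)"
      by simp
    then have "S powr (1 / q) \<le> B"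
      using S by simp
    then have "(S powr (1 / q)) powr q \<le> B powr q"
      using q by (intro powr_mono2) auto
    then show ?thesis
      using S q by (simp add: powr_powr)
  qed simp
  then show ?thesis
    unfolding S_eq B_def \<mu>_def by (rule ennreal_leI)
qed

text \<open>The truncation sets increase and exhaust the points with \<open>\<nu> z > 0\<close> and
  \<open>z\<close> nonzero, so the uniform bound survives monotone convergence; in particular the
  dual moment is finite.\<close>

lemma dual_moment_le:
  fixes n :: nat
  defines "q \<equiv> conj_exponent p"
  shows "2 * moment (dual_weight p \<omega> \<nu>) (real n * q + 1) \<le>
    ennreal ((C * disc_moment \<omega> n / radial_moment \<nu> (real n * p) powr (1 / p)) powr q)" (is "_ \<le> ?B")
proof -
  define E where "E m = {z. 1 / Suc m < cmod z \<and> 1 / Suc m < \<nu> z \<and> \<omega> z < Suc m}" for m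
  define t where "t z = cmod z powr (real n * q) * (\<omega> z / \<nu> z powr (1 / p)) powr q" for z
  define s where "s m z = indicator (E m) z * t z" for m z
  have t_meas [measurable]: "t \<in> borel_measurable disc_area"
    unfolding t_def by measurable
  have t_nonneg: "0 \<le> t z" for z by (simp add: t_def)
  have s_meas: "s m \<in> borel_measurable disc_area" for m
  proof -
    have "(\<lambda>z. if 1 / Suc m < cmod z \<and> 1 / Suc m < \<nu> z \<and> \<omega> z < Suc m then t z else 0) \<in> borel_measurable disc_area"
      by measurable
    also have "(\<lambda>z. if 1 / Suc m < cmod z \<and> 1 / Suc m < \<nu> z \<and> \<omega> z < Suc m then t z else 0) = s m"
      by (auto simp: s_def E_def indicator_def)
    finally show ?thesis .
  qed
  have E_mono: "E m \<subseteq> E (Suc m)" for m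
  proof -
    have "1 / real (Suc (Suc m)) \<le> 1 / real (Suc m)" by (simp add: field_simps)
    then show ?thesis unfolding E_def by (auto simp del: of_nat_Suc)
  qed
  have s_mono: "incseq (\<lambda>m z. ennreal (s m z))"
    using E_mono t_nonneg by (intro incseq_SucI le_funI ennreal_leI) (auto simp: s_def indicator_def)
  have dual_radial: "dual_weight p \<omega> \<nu> z = dual_weight p \<omega> \<nu> (of_real (cmod z))" if "z \<in> \<bbbD>" for z
    using \<omega>.weight_radial[OF that, symmetric] \<nu>.weight_radial[OF that, symmetric]
    by (simp add: dual_weight_def)
  have dual_meas: "dual_weight p \<omega> \<nu> \<in> borel_measurable disc_area"
    unfolding dual_weight_def by measurable
  have "2 * moment (dual_weight p \<omega> \<nu>) (real n * q + 1) =
      (\<integral>\<^sup>+ z. ennreal (cmod z powr (real n * q + 1 - 1)) * dual_weight p \<omega> \<nu> z \<partial>disc_area)"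
    by (rule moment_eq_disc_integral [OF dual_meas dual_radial, symmetric])
  \<comment> \<open>Where \<open>\<nu>\<close> vanishes, \<open>t\<close> is 0 because division by
    zero yields 0. By \<open>AE_zero_weight\<close> the dual weight is 0 there as well, up to a null
    set, so its value \<open>top\<close> does not contribute.\<close>
  also have "\<dots> = (\<integral>\<^sup>+ z. ennreal (t z) \<partial>disc_area)"
  proof (rule nn_integral_cong_AE)
    show "AE z in disc_area. ennreal (cmod z powr (real n * q + 1 - 1)) * dual_weight p \<omega> \<nu> z = ennreal (t z)"
      using AE_zero_weight
      by eventually_elim (auto simp: dual_weight_def t_def q_def ennreal_mult)
  qed
  also have "\<dots> \<le> (\<integral>\<^sup>+ z. (SUP m. ennreal (s m z)) \<partial>disc_area)"
  proof (rule nn_integral_mono_AE)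
    have "AE z in disc_area. z \<noteq> 0"
      unfolding AE_disc_area using AE_lborel_singleton[of "0::complex"] by eventually_elim auto
    then show "AE z in disc_area. ennreal (t z) \<le> (SUP m. ennreal (s m z))"
      using AE_space
    proof eventually_elim
      case (elim z)
      show ?case
      proof (cases "\<nu> z = 0")
        case True
        then show ?thesis by (simp add: t_def)
      next
        case False
        with \<nu>.weight_nonneg elim(2) have \<nu>: "0 < \<nu> z" by (simp add: less_le)
        have ev: "\<forall>\<^sub>F m in sequentially. inverse (real (Suc m)) < x" if "0 < x" for x
          using order_tendstoD(2)[OF LIMSEQ_inverse_real_of_nat that] .
        have "\<forall>\<^sub>F m in sequentially. \<omega> z < real (Suc m)"
          using filterlim_compose[OF filterlim_real_sequentially filterlim_Suc]
          by (simp add: filterlim_at_top_dense)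
        moreover have "\<forall>\<^sub>F m in sequentially. inverse (real (Suc m)) < cmod z"
          using elim(1) by (intro ev) simp
        ultimately have "\<forall>\<^sub>F m in sequentially. z \<in> E m"
          using ev[OF \<nu>] by eventually_elim (simp add: E_def inverse_eq_divide)
        then obtain m where "z \<in> E m"
          by (auto simp: eventually_sequentially)
        then have "ennreal (t z) = ennreal (s m z)" by (simp add: s_def)
        also have "\<dots> \<le> (SUP m. ennreal (s m z))" by (rule SUP_upper) simp
        finally show ?thesis .
      qed
    qed
  qed
  also have "\<dots> = (SUP m. \<integral>\<^sup>+ z. ennreal (s m z) \<partial>disc_area)"
    using s_meas by (intro nn_integral_monotone_convergence_SUP s_mono) auto
  also have "\<dots> \<le> ?B"
    using truncated_dual_integral_le[of _ n]
    by (intro SUP_least) (simp only: s_def t_def E_def q_def)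
  finally show ?thesis .
qed

lemma D_const_le: "D_const p \<omega> \<nu> \<le> ennreal C"
  unfolding D_const_def
proof (rule SUP_least)
  fix n :: nat
  define q where "q = conj_exponent p"
  define \<mu> where "\<mu> = radial_moment \<nu> (real n * p)"
  define d where "d = disc_moment \<omega> n"
  have q: "1 < q" and pq: "1 / p + 1 / q = 1"
    using conj_exponent_props[OF p] by (simp_all add: q_def)
  have \<mu>: "0 < \<mu>" and d: "0 < d"
    unfolding \<mu>_def d_def using p by (auto intro!: \<nu>.radial_moment_pos \<omega>.disc_moment_pos)
  define B where "B = C * d / \<mu> powr (1 / p)"
  have B: "0 \<le> B" using C_nonneg d by (simp add: B_def)
  have le: "2 * moment (dual_weight p \<omega> \<nu>) (real n * q + 1) \<le> ennreal (B powr q)"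
    unfolding B_def d_def \<mu>_def q_def by (rule dual_moment_le)
  define \<sigma> where "\<sigma> = enn2real (moment (dual_weight p \<omega> \<nu>) (real n * q + 1))"
  \<comment> \<open>Finiteness allows the rest of the computation to be done with real
    numbers.\<close>
  have "moment (dual_weight p \<omega> \<nu>) (real n * q + 1) \<noteq> top"
    using le by (auto simp: ennreal_mult_top top_unique)
  then have \<sigma>: "moment (dual_weight p \<omega> \<nu>) (real n * q + 1) = ennreal \<sigma>" "0 \<le> \<sigma>"
    by (auto simp: \<sigma>_def less_top)
  have "ennreal (2 * \<sigma>) \<le> ennreal (B powr q)"
    using le \<sigma> by (simp add: ennreal_mult)
  then have "2 * \<sigma> \<le> B powr q"
    by (subst (asm) ennreal_le_iff) auto
  then have "(2 * \<sigma>) powr (1 / q) \<le> (B powr q) powr (1 / q)"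
    using \<sigma>(2) q by (intro powr_mono2) auto
  then have \<sigma>_le: "(2 * \<sigma>) powr (1 / q) \<le> B"
    using B q by (simp add: powr_powr)
  have M\<nu>: "moment (\<lambda>z. ennreal (\<nu> z)) (real n * p + 1) = ennreal (\<mu> / 2)"
    using \<nu>.moment_eq_radial_moment[of "real n * p + 1"] p by (simp add: \<mu>_def)
  have M\<omega>: "moment (\<lambda>z. ennreal (\<omega> z)) (2 * real n + 1) = ennreal (d / 2)"
    using \<omega>.moment_eq_radial_moment[of "2 * real n + 1"]
    by (simp add: d_def \<omega>.disc_moment_eq_radial_moment)
  \<comment> \<open>The halves in the two numerator moments combine to a factor
    \<open>1 / 2\<close>, matching the half in the denominator.\<close>
  have two: "2 powr (1 / p) * 2 powr (1 / q) = (2::real)"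
    using pq by (simp add: powr_add [symmetric])
  have "(\<mu> / 2) powr (1 / p) * \<sigma> powr (1 / q) / (d / 2) =
      \<mu> powr (1 / p) * (2 * \<sigma>) powr (1 / q) / d * (2 / (2 powr (1 / p) * 2 powr (1 / q)))"
    using \<mu> \<sigma>(2) d by (simp add: powr_divide powr_mult mult_ac)
  also have "\<dots> = \<mu> powr (1 / p) * (2 * \<sigma>) powr (1 / q) / d"
    unfolding two by simp
  also have "\<dots> \<le> \<mu> powr (1 / p) * B / d"
    using \<sigma>_le d by (intro divide_right_mono mult_left_mono) auto
  also have "\<dots> = C"
    using \<mu> d by (simp add: B_def)
  finally have le_C: "ennreal ((\<mu> / 2) powr (1 / p) * \<sigma> powr (1 / q) / (d / 2)) \<le> ennreal C"
    by (rule ennreal_leI)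
  then show "enn_powr (moment (\<lambda>z. ennreal (\<nu> z)) (real n * p + 1)) (1 / p)
      * enn_powr (moment (dual_weight p \<omega> \<nu>) (real n * conj_exponent p + 1)) (1 / conj_exponent p)
      / moment (\<lambda>z. ennreal (\<omega> z)) (2 * real n + 1) \<le> ennreal C"
  proof -
    have "ennreal ((\<mu> / 2) powr (1 / p)) * ennreal (\<sigma> powr (1 / q)) / ennreal (d / 2) =
        ennreal ((\<mu> / 2) powr (1 / p) * \<sigma> powr (1 / q) / (d / 2))"
      using d by (subst ennreal_mult [symmetric], simp, simp, subst divide_ennreal) auto
    with le_C show ?thesis
      unfolding q_def [symmetric] M\<nu> M\<omega> \<sigma>(1)
      using \<mu> \<sigma>(2) by (simp add: enn_powr_def)
  qed
qed

end

theorem proposition1: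
  fixes \<omega> \<nu> :: "complex \<Rightarrow> real" and p :: real
  assumes "radial_weight \<omega>" and "radial_weight \<nu>" and "1 < p"
    and "bergman_projection_bounded p \<omega> \<nu>"
  shows "D_const p \<omega> \<nu> \<le> bergman_projection_norm p \<omega> \<nu>
    \<and> bergman_projection_norm p \<omega> \<nu> < top"
proof
  show "D_const p \<omega> \<nu> \<le> bergman_projection_norm p \<omega> \<nu>"
    unfolding bergman_projection_norm_def
  proof (rule Inf_greatest)
    fix C :: ennreal
    assume C: "C \<in> {C. \<forall>f\<in>Lp_space p \<nu>. Lp_norm p \<nu> (bergman_projection \<omega> f) \<le> C * Lp_norm p \<nu> f}"
    show "D_const p \<omega> \<nu> \<le> C"
    \<comment> \<open>An infinite constant bounds everything; a finite one is an instance of the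
      locale.\<close>
    proof (cases C)
      case (real c)
      interpret bounded_projection \<omega> \<nu> p c
        using assms C real by unfold_locales auto
      show ?thesis using D_const_le real by simp
    qed simp
  qed
  obtain C :: real where "\<forall>f\<in>Lp_space p \<nu>. Lp_norm p \<nu> (bergman_projection \<omega> f) \<le> ennreal C * Lp_norm p \<nu> f"
    using assms(4) unfolding bergman_projection_bounded_def by blast
  then have "bergman_projection_norm p \<omega> \<nu> \<le> ennreal C"
    unfolding bergman_projection_norm_def by (intro Inf_lower) simp
  then show "bergman_projection_norm p \<omega> \<nu> < top"
    using ennreal_less_top le_less_trans by blast
qed

end
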